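(* Let $G(n,p)$ be an Erdős–Rényi random graph on $n$ vertices with $p=\lambda/n$, where $\lambda=\lambda_n>1$ remains bounded away from $1$ as $n\to\infty$ (i.e. $\liminf_n \lambda_n>1$). Let $C_{\mathrm{giant}}$ denote its largest connected component, and let $h(n)$ be an arbitrary sequence with $h(n)\to\infty$. Then: (1) If $\lambda\le \ln(n)/8+\ln(\ln(n))-h(n)$, then with probability tending to one as $n\to\infty$, $C_{\mathrm{giant}}$ admits a cospectral mate. (2) If $\lambda\le \ln(n)/10+\ln(\ln(n))-h(n)$, then with probability tending to one as $n\to\infty$, $C_{\mathrm{giant}}$ admits an $\mathbb{R}$-cospectral mate.
   Context: Graphs are finite and simple. A cospectral mate of a graph $G$ is a graph not isomorphic to $G$ whose adjacency matrix has the same spectrum (eigenvalues with multiplicity) as that of $G$. Two graphs are $\mathbb{R}$-cospectral if they are non-isomorphic, cospectral, and their complement graphs are also cospectral; an $\mathbb{R}$-cospectral mate of $G$ is a graph $\mathbb{R}$-cospectral to $G$. In $G(n,p)$ each of the $\binom n2$ possible edges is present independently with probability $p$. *)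

theory Defs
  imports Complex_Main "Jordan_Normal_Form.Char_Poly"
begin

definition all_edges :: "nat set \<Rightarrow> nat set set" where
  "all_edges V = {e. e \<subseteq> V \<and> card e = 2}"

definition simple_graph :: "nat set \<Rightarrow> nat set set \<Rightarrow> bool" where
  "simple_graph V E \<longleftrightarrow> finite V \<and> E \<subseteq> all_edges V"

definition adj_mat :: "nat set \<Rightarrow> nat set set \<Rightarrow> real mat" where
  "adj_mat V E = (let xs = sorted_list_of_set V in
     mat (card V) (card V) (\<lambda>(i, j). if {xs ! i, xs ! j} \<in> E then 1 else 0))"

definition graph_iso :: "nat set \<Rightarrow> nat set set \<Rightarrow> nat set \<Rightarrow> nat set set \<Rightarrow> bool" where
  "graph_iso V E V' E' \<longleftrightarrow>
     (\<exists>f. bij_betw f V V' \<and> (\<forall>x\<in>V. \<forall>y\<in>V. {x, y} \<in> E \<longleftrightarrow> {f x, f y} \<in> E'))"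

text \<open>Same adjacency spectrum (eigenvalues with multiplicity) = same characteristic polynomial.\<close>
definition cospectral :: "nat set \<Rightarrow> nat set set \<Rightarrow> nat set \<Rightarrow> nat set set \<Rightarrow> bool" where
  "cospectral V E V' E' \<longleftrightarrow> char_poly (adj_mat V E) = char_poly (adj_mat V' E')"

definition compl_edges :: "nat set \<Rightarrow> nat set set \<Rightarrow> nat set set" where
  "compl_edges V E = all_edges V - E"

definition has_cospectral_mate :: "nat set \<Rightarrow> nat set set \<Rightarrow> bool" where
  "has_cospectral_mate V E \<longleftrightarrow>
     (\<exists>V' E'. simple_graph V' E' \<and> \<not> graph_iso V E V' E' \<and> cospectral V E V' E')"

definition has_R_cospectral_mate :: "nat set \<Rightarrow> nat set set \<Rightarrow> bool" where
  "has_R_cospectral_mate V E \<longleftrightarrow>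
     (\<exists>V' E'. simple_graph V' E' \<and> \<not> graph_iso V E V' E' \<and> cospectral V E V' E'
        \<and> cospectral V (compl_edges V E) V' (compl_edges V' E'))"

definition component_of :: "nat set \<Rightarrow> nat set set \<Rightarrow> nat \<Rightarrow> nat set" where
  "component_of V E v = {w \<in> V. (\<lambda>x y. {x, y} \<in> E)\<^sup>*\<^sup>* v w}"

definition components :: "nat set \<Rightarrow> nat set set \<Rightarrow> nat set set" where
  "components V E = component_of V E ` V"

definition largest_components :: "nat set \<Rightarrow> nat set set \<Rightarrow> nat set set" where
  "largest_components V E =
     {C \<in> components V E. \<forall>C' \<in> components V E. card C' \<le> card C}"

definition induced_edges :: "nat set set \<Rightarrow> nat set \<Rightarrow> nat set set" where
  "induced_edges E C = {e \<in> E. e \<subseteq> C}"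

definition gnp_prob :: "nat \<Rightarrow> real \<Rightarrow> (nat set set \<Rightarrow> bool) \<Rightarrow> real" where
  "gnp_prob n p P = (\<Sum>E \<in> Pow (all_edges {0..<n}).
      (if P E then p ^ card E * (1 - p) ^ (card (all_edges {0..<n}) - card E) else 0))"

end

theory Submission
  imports Defs "HOL-Real_Asymp.Real_Asymp"
begin

text \<open>Call a \<open>k\<close>-set of vertices that induces a fixed rooted tree and is joined to the rest of the
  graph by a single edge at its root a limb. If a component contains a limb that is the spider
  with three legs of length two rooted at a middle vertex (\<open>k = 7\<close>), then Godsil--McKay switching on
  the center and the three leaves isolates the center. The result is cospectral with cospectral
  complement, and not isomorphic because the component has no isolated vertex.

  For \<open>\<lambda> \<le> ln n / 8 + ln (ln n)\<close> the expected number of limbs is of order \<open>n \<lambda>^7 exp (- 7 \<lambda>)\<close>, which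
  exceeds a power of \<open>n\<close>, and by Chebyshev's inequality some number \<open>L\<close> of that order is present.
  If a largest component \<open>C\<close> with at least \<open>m\<close> vertices has no limb, detach one of the limbs and
  attach it to a vertex of \<open>C\<close> instead: the new graph has the same probability, its unique
  largest component is \<open>C\<close> with the limb added, and this limb is the only one there. So the old graph
  is determined by the new one and the old attachment vertex, and double counting bounds the
  probability of such graphs by \<open>n / (L m)\<close>. For \<open>\<lambda> > 9\<close> one may take \<open>m = n / 3\<close>, as otherwise there
  would be a balanced cut without edges. For \<open>\<lambda> \<le> 9\<close> the number \<open>L\<close> is linear in \<open>n\<close>, so an arbitrarily
  large constant \<open>m\<close> suffices; components of that size exist because limbs with \<open>m\<close> vertices do.\<close>

section \<open>Expectations in the random graph\<close>

definition edge_weight :: "nat \<Rightarrow> real \<Rightarrow> nat set set \<Rightarrow> real" where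
  "edge_weight n p E = p ^ card E * (1 - p) ^ (card (all_edges {0..<n}) - card E)"

definition gnp_expect :: "nat \<Rightarrow> real \<Rightarrow> (nat set set \<Rightarrow> real) \<Rightarrow> real" where
  "gnp_expect n p f = (\<Sum>E\<in>Pow (all_edges {0..<n}). f E * edge_weight n p E)"

lemma finite_all_edges [simp]: "finite V \<Longrightarrow> finite (all_edges V)"
  unfolding all_edges_def by (rule finite_subset[of _ "Pow V"]) auto

lemma all_edges_iff: "{x, y} \<in> all_edges V \<longleftrightarrow> x \<in> V \<and> y \<in> V \<and> x \<noteq> y"
  unfolding all_edges_def by (cases "x = y") auto

lemma gnp_prob_eq_expect: "gnp_prob n p P = gnp_expect n p (\<lambda>E. of_bool (P E))"
  unfolding gnp_prob_def gnp_expect_def edge_weight_def by (intro sum.cong) auto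

lemma edge_weight_nonneg: "0 \<le> p \<Longrightarrow> p \<le> 1 \<Longrightarrow> 0 \<le> edge_weight n p E"
  unfolding edge_weight_def by simp

text \<open>Total mass one of independent coin flips on \<open>A\<close>: subsets without
  \<open>a\<close> contribute a factor \<open>1 - p\<close>, those with \<open>a\<close> a factor
  \<open>p\<close>.\<close>

lemma sum_Pow_binomial:
  fixes p :: real
  assumes "finite A"
  shows "(\<Sum>E\<in>Pow A. p ^ card E * (1 - p) ^ (card A - card E)) = 1"
  using assms
proof (induction A rule: finite_induct)
  case (insert a A)
  have fin: "finite E" if "E \<in> Pow A" for E
    using that insert.hyps(1) finite_subset by auto
  have inj: "inj_on (insert a) (Pow A)"
    using insert.hyps(2) by (auto simp: inj_on_def)
  have disj: "Pow A \<inter> insert a ` Pow A = {}"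
    using insert.hyps(2) by auto
  let ?f = "\<lambda>m E. p ^ card E * (1 - p) ^ (m - card E)"
  have "(\<Sum>E\<in>Pow (insert a A). ?f (card (insert a A)) E)
      = (\<Sum>E\<in>Pow A. ?f (Suc (card A)) E) + (\<Sum>E\<in>Pow A. ?f (Suc (card A)) (insert a E))"
    unfolding Pow_insert using insert.hyps disj inj by (simp add: sum.union_disjoint sum.reindex)
  also have "(\<Sum>E\<in>Pow A. ?f (Suc (card A)) E) = (1 - p) * (\<Sum>E\<in>Pow A. ?f (card A) E)"
    unfolding sum_distrib_left
    by (intro sum.cong refl) (simp add: Suc_diff_le card_mono insert.hyps(1))
  also have "(\<Sum>E\<in>Pow A. ?f (Suc (card A)) (insert a E)) = p * (\<Sum>E\<in>Pow A. ?f (card A) E)"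
    unfolding sum_distrib_left
  proof (intro sum.cong refl)
    fix E assume E: "E \<in> Pow A"
    then have "card (insert a E) = Suc (card E)"
      using insert.hyps(2) fin[OF E] by (subst card_insert_disjoint) auto
    then show "?f (Suc (card A)) (insert a E) = p * ?f (card A) E" by simp
  qed
  finally show ?case using insert.IH by simp
qed simp

lemma gnp_expect_one: "gnp_expect n p (\<lambda>_. 1) = 1"
  unfolding gnp_expect_def edge_weight_def by (simp add: sum_Pow_binomial)

text \<open>Pairs outside \<open>M\<close> are independent of those inside, so their weights factor
  out and sum to one. Every explicit probability below (one limb, two limbs, an empty cut) comes
  from such a cylinder event.\<close>

lemma gnp_prob_cylinder:
  assumes "M \<subseteq> all_edges {0..<n}" "F \<subseteq> M"
  shows "gnp_prob n p (\<lambda>E. E \<inter> M = F) = p ^ card F * (1 - p) ^ (card M - card F)"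
proof -
  define A where "A = all_edges {0..<n}"
  have fA: "finite A" unfolding A_def by simp
  have MA: "M \<subseteq> A" using assms unfolding A_def by simp
  have fM: "finite M" and fF: "finite F" using MA fA assms(2) by (auto intro: finite_subset)
  have inj: "inj_on (\<lambda>E. F \<union> E) (Pow (A - M))"
  proof (rule inj_onI)
    fix E E' assume *: "E \<in> Pow (A - M)" "E' \<in> Pow (A - M)" "F \<union> E = F \<union> E'"
    have "E = (F \<union> E) - M" "E' = (F \<union> E') - M" using *(1,2) assms(2) by auto
    then show "E = E'" using *(3) by metis
  qed
  have img: "{E \<in> Pow A. E \<inter> M = F} = (\<lambda>E. F \<union> E) ` Pow (A - M)"
  proof (intro subset_antisym subsetI)
    fix E assume "E \<in> {E \<in> Pow A. E \<inter> M = F}"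
    then have "E = F \<union> (E - M)" "E - M \<in> Pow (A - M)" by auto
    then show "E \<in> (\<lambda>E. F \<union> E) ` Pow (A - M)" by (rule image_eqI)
  qed (use assms(2) MA in auto)
  have "gnp_prob n p (\<lambda>E. E \<inter> M = F)
      = (\<Sum>E\<in>Pow A. if E \<inter> M = F then edge_weight n p E else 0)"
    unfolding gnp_prob_eq_expect gnp_expect_def A_def[symmetric] by (intro sum.cong refl) simp
  also have "\<dots> = (\<Sum>E\<in>{E \<in> Pow A. E \<inter> M = F}. edge_weight n p E)"
    using fA by (simp only: sum.inter_filter finite_Pow_iff)
  also have "\<dots> = (\<Sum>E\<in>Pow (A - M). edge_weight n p (F \<union> E))"
    unfolding img sum.reindex[OF inj] comp_def ..
  also have "\<dots> = (\<Sum>E\<in>Pow (A - M). (p ^ card F * (1 - p) ^ (card M - card F)) *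
      (p ^ card E * (1 - p) ^ (card (A - M) - card E)))"
  proof (intro sum.cong refl)
    fix E assume E: "E \<in> Pow (A - M)"
    then have fE: "finite E" using fA by (auto intro: finite_subset)
    have c1: "card (F \<union> E) = card F + card E"
      using E assms(2) fE fF by (intro card_Un_disjoint) auto
    have c2: "card E \<le> card (A - M)" using E fA by (intro card_mono) auto
    have c3: "card (A - M) = card A - card M" using MA fM by (rule card_Diff_subset[rotated])
    have c4: "card F \<le> card M" "card M \<le> card A" using assms(2) MA fM fA by (auto intro: card_mono)
    have "card A - card (F \<union> E) = (card M - card F) + (card (A - M) - card E)"
      using c1 c2 c3 c4 by linarith
    then show "edge_weight n p (F \<union> E) = (p ^ card F * (1 - p) ^ (card M - card F)) *
      (p ^ card E * (1 - p) ^ (card (A - M) - card E))"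
      unfolding edge_weight_def A_def[symmetric] c1 by (simp add: power_add)
  qed
  also have "\<dots> = p ^ card F * (1 - p) ^ (card M - card F)"
    unfolding sum_distrib_left[symmetric] using fA by (simp add: sum_Pow_binomial)
  finally show ?thesis .
qed

section \<open>Linearity, monotonicity and the union bound\<close>

lemma gnp_expect_mono:
  assumes "0 \<le> p" "p \<le> 1" "\<And>E. E \<subseteq> all_edges {0..<n} \<Longrightarrow> f E \<le> g E"
  shows "gnp_expect n p f \<le> gnp_expect n p g"
  unfolding gnp_expect_def using assms edge_weight_nonneg
  by (intro sum_mono mult_right_mono) auto

lemma gnp_expect_sum: "gnp_expect n p (\<lambda>E. \<Sum>i\<in>I. f i E) = (\<Sum>i\<in>I. gnp_expect n p (f i))"
  unfolding gnp_expect_def sum_distrib_right by (rule sum.swap)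

lemma gnp_expect_add: "gnp_expect n p (\<lambda>E. f E + g E) = gnp_expect n p f + gnp_expect n p g"
  unfolding gnp_expect_def by (simp add: distrib_right sum.distrib)

lemma gnp_expect_cmult: "gnp_expect n p (\<lambda>E. c * f E) = c * gnp_expect n p f"
  unfolding gnp_expect_def by (simp add: sum_distrib_left mult.assoc)

lemma gnp_expect_const: "gnp_expect n p (\<lambda>E. c) = c"
  using gnp_expect_cmult[of n p c "\<lambda>_. 1"] by (simp add: gnp_expect_one)

lemma gnp_prob_nonneg: "0 \<le> p \<Longrightarrow> p \<le> 1 \<Longrightarrow> 0 \<le> gnp_prob n p P"
  unfolding gnp_prob_eq_expect gnp_expect_def by (intro sum_nonneg) (simp add: edge_weight_nonneg)

lemma gnp_prob_mono:
  assumes "0 \<le> p" "p \<le> 1" "\<And>E. E \<subseteq> all_edges {0..<n} \<Longrightarrow> P E \<Longrightarrow> Q E"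
  shows "gnp_prob n p P \<le> gnp_prob n p Q"
  unfolding gnp_prob_eq_expect using assms by (intro gnp_expect_mono) (auto simp: of_bool_def)

lemma gnp_prob_disj_le:
  assumes "0 \<le> p" "p \<le> 1"
  shows "gnp_prob n p (\<lambda>E. P E \<or> Q E) \<le> gnp_prob n p P + gnp_prob n p Q"
  unfolding gnp_prob_eq_expect gnp_expect_add[symmetric]
  using assms by (intro gnp_expect_mono) (auto simp: of_bool_def)

lemma gnp_prob_not: "gnp_prob n p (\<lambda>E. \<not> P E) = 1 - gnp_prob n p P"
proof -
  have "gnp_prob n p P + gnp_prob n p (\<lambda>E. \<not> P E) = gnp_expect n p (\<lambda>_. 1)"
    unfolding gnp_prob_eq_expect gnp_expect_add[symmetric]
    by (rule arg_cong[where f = "gnp_expect n p"]) (auto simp: of_bool_def)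
  then show ?thesis by (simp add: gnp_expect_one)
qed

lemma gnp_prob_le_one: "0 \<le> p \<Longrightarrow> p \<le> 1 \<Longrightarrow> gnp_prob n p P \<le> 1"
  using gnp_prob_not[of n p P] gnp_prob_nonneg[of p n "\<lambda>E. \<not> P E"] by linarith

lemma gnp_prob_Bex_le:
  assumes "0 \<le> p" "p \<le> 1" "finite I"
  shows "gnp_prob n p (\<lambda>E. \<exists>i\<in>I. P i E) \<le> (\<Sum>i\<in>I. gnp_prob n p (P i))"
  unfolding gnp_prob_eq_expect gnp_expect_sum[symmetric]
proof (intro gnp_expect_mono assms)
  fix E
  show "of_bool (\<exists>i\<in>I. P i E) \<le> (\<Sum>i\<in>I. of_bool (P i E) :: real)"
  proof (cases "\<exists>i\<in>I. P i E")
    case True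
    then obtain j where "j \<in> I" "P j E" by blast
    then have "(of_bool (P j E) :: real) \<le> (\<Sum>i\<in>I. of_bool (P i E))"
      using assms(3) by (intro member_le_sum) auto
    then show ?thesis using \<open>P j E\<close> by simp
  qed (simp add: sum_nonneg)
qed

section \<open>Limbs\<close>

text \<open>The vertices of a tree on \<open>{0..<k}\<close>, given by a parent function, are matched with those of a
  \<open>k\<close>-set \<open>S\<close> in increasing order; each \<open>S\<close> thus carries exactly one copy of the tree, and limbs
  can be counted by their vertex sets.\<close>

definition vtx :: "nat set \<Rightarrow> nat \<Rightarrow> nat" where
  "vtx S i = sorted_list_of_set S ! i"

definition tree_edges :: "(nat \<Rightarrow> nat) \<Rightarrow> nat set \<Rightarrow> nat set set" where
  "tree_edges par S = (\<lambda>i. {vtx S i, vtx S (par i)}) ` {1..<card S}"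

definition limb_edges :: "(nat \<Rightarrow> nat) \<Rightarrow> nat set \<Rightarrow> nat \<Rightarrow> nat set set" where
  "limb_edges par S w = insert {vtx S 0, w} (tree_edges par S)"

definition touching :: "nat set set \<Rightarrow> nat set \<Rightarrow> nat set set" where
  "touching E S = {e \<in> E. e \<inter> S \<noteq> {}}"

text \<open>Equality rather than inclusion: for \<open>w\<close> outside \<open>S\<close>, the set
  \<open>S\<close> then induces exactly the tree, the root edge is its only exit, and the event is a
  cylinder over the pairs meeting \<open>S\<close>.\<close>

definition is_limb :: "(nat \<Rightarrow> nat) \<Rightarrow> nat set set \<Rightarrow> nat set \<Rightarrow> nat \<Rightarrow> bool" where
  "is_limb par E S w \<longleftrightarrow> touching E S = limb_edges par S w"

lemma bij_betw_vtx: "finite S \<Longrightarrow> bij_betw (vtx S) {0..<card S} S"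
  unfolding vtx_def
  by (metis bij_betw_nth atLeast0LessThan distinct_sorted_list_of_set length_sorted_list_of_set
      set_sorted_list_of_set)

lemma vtx_in: "finite S \<Longrightarrow> i < card S \<Longrightarrow> vtx S i \<in> S"
  using bij_betw_vtx[of S] by (auto simp: bij_betw_def)

lemma vtx_inj: "finite S \<Longrightarrow> i < card S \<Longrightarrow> j < card S \<Longrightarrow> vtx S i = vtx S j \<longleftrightarrow> i = j"
  using bij_betw_vtx[of S] by (auto simp: bij_betw_def inj_on_def)

lemma vtx_surj: "finite S \<Longrightarrow> x \<in> S \<Longrightarrow> \<exists>i<card S. x = vtx S i"
  using bij_betw_vtx[of S] unfolding bij_betw_def by (metis atLeastLessThan_iff imageE)

text \<open>Parents with smaller labels rule out cycles, and induction on the label joins every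
  vertex to the root \<open>0\<close>.\<close>

locale parent_tree =
  fixes par :: "nat \<Rightarrow> nat"
  assumes par_less: "1 \<le> i \<Longrightarrow> par i < i"
begin

lemma tree_edges_subset:
  assumes "finite S" "e \<in> tree_edges par S"
  shows "e \<subseteq> S" "e \<in> all_edges S"
proof -
  obtain i where i: "1 \<le> i" "i < card S" "e = {vtx S i, vtx S (par i)}"
    using assms(2) unfolding tree_edges_def by auto
  have "vtx S i \<in> S" "vtx S (par i) \<in> S" "vtx S i \<noteq> vtx S (par i)"
    using vtx_in[OF assms(1)] vtx_inj[OF assms(1)] par_less[OF i(1)] i(2) by auto
  then show "e \<subseteq> S" "e \<in> all_edges S" using i(3) by (auto simp: all_edges_iff)
qed

lemma card_tree_edges:
  assumes "finite S"
  shows "card (tree_edges par S) = card S - 1"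
proof -
  have "inj_on (\<lambda>i. {vtx S i, vtx S (par i)}) {1..<card S}"
  proof (rule inj_onI)
    fix i j assume ij: "i \<in> {1..<card S}" "j \<in> {1..<card S}"
      "{vtx S i, vtx S (par i)} = {vtx S j, vtx S (par j)}"
    \<comment> \<open>The child is the end with the larger label, so an unordered tree edge
      determines its child.\<close>
    have "par i < i" "par j < j" using ij par_less by auto
    then show "i = j" using ij vtx_inj[OF assms] by (auto simp: doubleton_eq_iff)
  qed
  then show ?thesis unfolding tree_edges_def by (simp add: card_image)
qed

text \<open>Connectedness of the tree in cut form: without a crossing edge, each vertex would agree
  with its parent, and so with the root, about membership in \<open>A\<close>.\<close>

lemma tree_edge_crossing:
  assumes "finite S" "S \<inter> A \<noteq> {}" "\<not> S \<subseteq> A"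
  shows "\<exists>e\<in>tree_edges par S. e \<inter> A \<noteq> {} \<and> \<not> e \<subseteq> A"
proof (rule ccontr)
  assume "\<not> ?thesis"
  then have *: "vtx S i \<in> A \<longleftrightarrow> vtx S (par i) \<in> A" if "1 \<le> i" "i < card S" for i
    using that unfolding tree_edges_def by force
  have "vtx S i \<in> A \<longleftrightarrow> vtx S 0 \<in> A" if "i < card S" for i
    using that
  proof (induction i rule: less_induct)
    case (less i)
    show ?case
    proof (cases "i = 0")
      case False
      then have i: "1 \<le> i" by simp
      with par_less less.prems have "par i < i" "par i < card S" by (auto intro: less_trans)
      from less.IH[OF this] *[OF i less.prems] show ?thesis by blast
    qed simp
  qed
  then have "x \<in> A \<longleftrightarrow> vtx S 0 \<in> A" if "x \<in> S" for x
    using vtx_surj[OF assms(1) that] by auto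
  then show False using assms(2,3) by blast
qed

lemma limb_edges_subset:
  assumes "finite S" "e \<in> limb_edges par S w" "e \<noteq> {vtx S 0, w}"
  shows "e \<subseteq> S"
  using assms tree_edges_subset unfolding limb_edges_def by auto

lemma card_limb_edges:
  assumes "finite S" "w \<notin> S" "S \<noteq> {}"
  shows "card (limb_edges par S w) = card S"
proof -
  have "{vtx S 0, w} \<notin> tree_edges par S" using tree_edges_subset[OF assms(1)] assms(2) by blast
  moreover have "finite (tree_edges par S)" unfolding tree_edges_def by simp
  moreover have "card S \<ge> 1" using assms by (simp add: Suc_le_eq card_gt_0_iff)
  ultimately show ?thesis unfolding limb_edges_def using card_tree_edges[OF assms(1)] by simp
qed

lemma limb_edges_subset_touching:
  assumes "S \<subseteq> {0..<n}" "w < n" "w \<notin> S" "S \<noteq> {}"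
  shows "limb_edges par S w \<subseteq> touching (all_edges {0..<n}) S"
proof
  fix e assume e: "e \<in> limb_edges par S w"
  have fS: "finite S" using assms(1) finite_subset by auto
  have r: "vtx S 0 \<in> S" using fS assms(4) vtx_in[of S 0] by (simp add: card_gt_0_iff)
  show "e \<in> touching (all_edges {0..<n}) S"
  proof (cases "e = {vtx S 0, w}")
    case True
    then show ?thesis using r assms unfolding touching_def by (auto simp: all_edges_iff)
  next
    case False
    then have "e \<in> tree_edges par S" using e unfolding limb_edges_def by auto
    from tree_edges_subset[OF fS this] have "e \<subseteq> S" "card e = 2"
      unfolding all_edges_def by auto
    moreover from this have "e \<noteq> {}" by auto
    ultimately show ?thesis using assms(1) unfolding touching_def all_edges_def by auto
  qed
qed

end

section \<open>The number of limbs is concentrated\<close>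

text \<open>Taking the attachment vertex from outside the half that contains the limbs makes two
  overlapping limbs mutually exclusive, so that only disjoint pairs enter the second moment.\<close>

definition limb_index :: "nat \<Rightarrow> nat \<Rightarrow> (nat set \<times> nat) set" where
  "limb_index n k = {S. S \<subseteq> {0..<n div 2} \<and> card S = k} \<times> {n div 2..<n}"

definition limb_count :: "(nat \<Rightarrow> nat) \<Rightarrow> nat \<Rightarrow> nat \<Rightarrow> nat set set \<Rightarrow> nat" where
  "limb_count par n k E = card {(S, w) \<in> limb_index n k. is_limb par E S w}"

text \<open>The exponent of \<open>1 - p\<close> is the number of pairs meeting a fixed
  \<open>k\<close>-set, less the \<open>k\<close> limb edges among them.\<close>

definition limb_prob :: "nat \<Rightarrow> real \<Rightarrow> nat \<Rightarrow> real" where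
  "limb_prob n p k = p ^ k * (1 - p) ^ ((n choose 2) - ((n - k) choose 2) - k)"

definition limb_mean :: "nat \<Rightarrow> real \<Rightarrow> nat \<Rightarrow> real" where
  "limb_mean n p k = real (card (limb_index n k)) * limb_prob n p k"

section \<open>Counting pairs that meet a vertex set\<close>

lemma card_all_edges: "finite V \<Longrightarrow> card (all_edges V) = card V choose 2"
  unfolding all_edges_def by (rule n_subsets)

lemma touching_subset: "touching E S \<subseteq> E"
  unfolding touching_def by auto

lemma touching_Int:
  assumes "E \<subseteq> A" shows "touching E S = E \<inter> touching A S"
  using assms unfolding touching_def by auto

lemma card_touching_all_edges:
  assumes "S \<subseteq> {0..<n}"
  shows "card (touching (all_edges {0..<n}) S) = (n choose 2) - ((n - card S) choose 2)"
proof -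
  have fS: "finite S" using assms finite_subset by auto
  have "touching (all_edges {0..<n}) S = all_edges {0..<n} - all_edges ({0..<n} - S)"
    unfolding touching_def all_edges_def by auto
  moreover have "all_edges ({0..<n} - S) \<subseteq> all_edges {0..<n}" unfolding all_edges_def by auto
  moreover have "card (all_edges ({0..<n} - S)) = (n - card S) choose 2"
    using assms fS by (simp add: card_all_edges card_Diff_subset)
  ultimately show ?thesis
    by (simp add: card_Diff_subset card_all_edges)
qed

lemma finite_limb_index [simp]: "finite (limb_index n k)"
  unfolding limb_index_def by (intro finite_cartesian_product) (auto intro: finite_subset)

lemma limb_indexD:
  assumes "(S, w) \<in> limb_index n k" "1 \<le> k"
  shows "S \<subseteq> {0..<n}" "card S = k" "w < n" "w \<notin> S" "S \<noteq> {}" "finite S"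
    "\<And>S' w'. (S', w') \<in> limb_index n k \<Longrightarrow> w \<notin> S'"
proof -
  have S: "S \<subseteq> {0..<n div 2}" "card S = k" "n div 2 \<le> w" "w < n"
    using assms unfolding limb_index_def by auto
  show "finite S" using S(1) by (rule finite_subset) simp
  have "{0..<n div 2} \<subseteq> {0..<n}" by (simp add: ivl_subset)
  with S(1) show "S \<subseteq> {0..<n}" by (rule subset_trans)
  show "card S = k" "w < n" by fact+
  show "S \<noteq> {}" using S(2) assms(2) by auto
  show "w \<notin> S" using S(1,3) by auto
  show "w \<notin> S'" if "(S', w') \<in> limb_index n k" for S' w'
    using that S(3) unfolding limb_index_def by auto
qed

lemma limb_count_eq_sum:
  "real (limb_count par n k E) = (\<Sum>i\<in>limb_index n k. of_bool (is_limb par E (fst i) (snd i)))"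
proof -
  have "{(S, w) \<in> limb_index n k. is_limb par E S w}
      = {i \<in> limb_index n k. is_limb par E (fst i) (snd i)}" by auto
  then show ?thesis unfolding limb_count_def
    by (simp add: of_bool_def sum.inter_filter[symmetric])
qed

text \<open>A pair meeting two disjoint sets has one end in each. This measures how far two disjoint
  limbs are from being independent.\<close>

lemma card_touching_Int_le:
  assumes "finite S" "finite S'" "S \<inter> S' = {}"
  shows "card (touching (all_edges V) S \<inter> touching (all_edges V) S') \<le> card S * card S'"
proof -
  have "touching (all_edges V) S \<inter> touching (all_edges V) S' \<subseteq> (\<lambda>(x, y). {x, y}) ` (S \<times> S')"
  proof
    fix e assume e: "e \<in> touching (all_edges V) S \<inter> touching (all_edges V) S'"
    then obtain x y where xy: "x \<in> e" "x \<in> S" "y \<in> e" "y \<in> S'" unfolding touching_def by auto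
    have "x \<noteq> y" using xy assms(3) by auto
    have c: "card e = 2" using e unfolding touching_def all_edges_def by auto
    have "{x, y} = e"
      using c xy \<open>x \<noteq> y\<close> by (intro card_subset_eq) (auto intro: card_ge_0_finite)
    then show "e \<in> (\<lambda>(x, y). {x, y}) ` (S \<times> S')" using xy by force
  qed
  then have "card (touching (all_edges V) S \<inter> touching (all_edges V) S')
      \<le> card ((\<lambda>(x, y). {x, y}) ` (S \<times> S'))"
    using assms by (intro card_mono) auto
  also have "\<dots> \<le> card (S \<times> S')" using assms by (intro card_image_le) auto
  finally show ?thesis by (simp add: card_cartesian_product)
qed

section \<open>Overlapping limbs, joint probabilities and the second moment\<close>

context parent_tree
begin

lemma limb_edges_attach_inj:
  assumes "finite S" "w \<notin> S" "w' \<notin> S" "limb_edges par S w = limb_edges par S w'"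
  shows "w = w'"
proof -
  have "{vtx S 0, w} \<in> limb_edges par S w'" using assms(4) unfolding limb_edges_def by auto
  moreover have "{vtx S 0, w} \<notin> tree_edges par S" using tree_edges_subset[OF assms(1)] assms(2) by blast
  ultimately have "{vtx S 0, w} = {vtx S 0, w'}" unfolding limb_edges_def by auto
  then show ?thesis by (auto simp: doubleton_eq_iff)
qed

lemma is_limb_tree_edge: "is_limb par E S w \<Longrightarrow> e \<in> tree_edges par S \<Longrightarrow> e \<in> E"
  unfolding is_limb_def limb_edges_def touching_def by blast

text \<open>As \<open>S\<close> is not contained in \<open>S'\<close>, some tree edge of
  \<open>S\<close> leaves \<open>S'\<close>. The only edge leaving \<open>S'\<close> is its root
  edge, so \<open>w'\<close> is an end of that tree edge.\<close>

lemma is_limb_crossing: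
  assumes "finite S" "finite S'" "card S = card S'" "S \<inter> S' \<noteq> {}" "S \<noteq> S'"
    and "is_limb par E S w" "is_limb par E S' w'"
  shows "w' \<in> S"
proof -
  have "\<not> S \<subseteq> S'" using assms(2,3,5) card_subset_eq by metis
  from tree_edge_crossing[OF assms(1,4) this]
  obtain e where e: "e \<in> tree_edges par S" "e \<inter> S' \<noteq> {}" "\<not> e \<subseteq> S'" by auto
  have "e \<in> touching E S'" using is_limb_tree_edge[OF assms(6) e(1)] e(2) unfolding touching_def by auto
  then have "e = {vtx S' 0, w'}"
    using assms(7) e(3) limb_edges_subset[OF assms(2)] unfolding is_limb_def by auto
  then show ?thesis using tree_edges_subset(1)[OF assms(1) e(1)] by auto
qed

lemma gnp_prob_is_limb:
  assumes "i \<in> limb_index n k" "1 \<le> k"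
  shows "gnp_prob n p (\<lambda>E. is_limb par E (fst i) (snd i)) = limb_prob n p k"
proof -
  obtain S w where i: "i = (S, w)" using surj_pair[of i] by blast
  note S = limb_indexD(1-6)[OF assms[unfolded i]]
  have "gnp_prob n p (\<lambda>E. is_limb par E S w)
      = gnp_prob n p (\<lambda>E. E \<inter> touching (all_edges {0..<n}) S = limb_edges par S w)"
    unfolding gnp_prob_def is_limb_def
  proof (intro sum.cong refl)
    fix E assume "E \<in> Pow (all_edges {0..<n})"
    then have "touching E S = E \<inter> touching (all_edges {0..<n}) S" by (intro touching_Int) simp
    then show "(if touching E S = limb_edges par S w
         then p ^ card E * (1 - p) ^ (card (all_edges {0..<n}) - card E) else 0) =
       (if E \<inter> touching (all_edges {0..<n}) S = limb_edges par S w
         then p ^ card E * (1 - p) ^ (card (all_edges {0..<n}) - card E) else 0)" by simp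
  qed
  also have "\<dots> = limb_prob n p k"
    unfolding limb_prob_def
    using gnp_prob_cylinder[OF touching_subset limb_edges_subset_touching[OF S(1,3,4,5)]]
    by (simp add: card_limb_edges[OF S(6,4,5)] card_touching_all_edges[OF S(1)] S(2))
  finally show ?thesis unfolding i by simp
qed

text \<open>Overlapping limbs from the index set exclude each other. For disjoint ones, the product
  of the two probabilities counts the non-edges in \<open>M \<inter> M'\<close> twice; there are at
  most \<open>k\<^sup>2\<close> of them, and the denominator makes up for this.\<close>

lemma gnp_prob_two_limbs:
  assumes i: "i \<in> limb_index n k" and j: "j \<in> limb_index n k" and "i \<noteq> j" "1 \<le> k" "0 < p" "p < 1"
  shows "gnp_prob n p (\<lambda>E. is_limb par E (fst i) (snd i) \<and> is_limb par E (fst j) (snd j))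
    \<le> (limb_prob n p k)\<^sup>2 / (1 - p) ^ (k\<^sup>2)"
proof -
  obtain S w where iS: "i = (S, w)" using surj_pair[of i] by blast
  obtain S' w' where jS: "j = (S', w')" using surj_pair[of j] by blast
  note i' = i[unfolded iS] and j' = j[unfolded jS]
  note S = limb_indexD(1-6)[OF i' \<open>1 \<le> k\<close>] limb_indexD(7)[OF j' \<open>1 \<le> k\<close> i']
  note S' = limb_indexD(1-6)[OF j' \<open>1 \<le> k\<close>] limb_indexD(7)[OF i' \<open>1 \<le> k\<close> j']
  have nn: "0 \<le> (limb_prob n p k)\<^sup>2 / (1 - p) ^ (k\<^sup>2)" using assms by simp
  show ?thesis
  proof (cases "S \<inter> S' = {}")
    case False
    have "\<not> (is_limb par E S w \<and> is_limb par E S' w')" for E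
    proof
      assume *: "is_limb par E S w \<and> is_limb par E S' w'"
      show False
      proof (cases "S = S'")
        case True
        then have "w \<noteq> w'" using \<open>i \<noteq> j\<close> iS jS by auto
        moreover have "limb_edges par S w = limb_edges par S w'"
          using * True unfolding is_limb_def by auto
        ultimately show False using limb_edges_attach_inj[OF S(6,4,7)] by blast
      next
        case neq: False
        from is_limb_crossing[OF S(6) S'(6) _ False neq] * S S' show False by auto
      qed
    qed
    then have "(\<lambda>E. is_limb par E S w \<and> is_limb par E S' w') = (\<lambda>_. False)" by (simp only: simp_thms)
    then show ?thesis using nn unfolding iS jS fst_conv snd_conv by (simp add: gnp_prob_def)
  next
    case disj: True
    define A where "A = all_edges {0..<n}"
    define M where "M = touching A S"
    define M' where "M' = touching A S'"
    define F where "F = limb_edges par S w"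
    define F' where "F' = limb_edges par S' w'"
    have fA: "finite A" unfolding A_def by simp
    have MA: "M \<subseteq> A" "M' \<subseteq> A" unfolding M_def M'_def by (rule touching_subset)+
    then have fM: "finite M" "finite M'" using fA finite_subset by auto
    have FM: "F \<subseteq> M" "F' \<subseteq> M'" unfolding F_def F'_def M_def M'_def A_def
      using limb_edges_subset_touching[OF S(1,3,4,5)] limb_edges_subset_touching[OF S'(1,3,4,5)] by auto
    then have fF: "finite F" "finite F'" using fM finite_subset by auto
    have cF: "card F = k" "card F' = k" unfolding F_def F'_def
      using card_limb_edges S S' by auto
    have "F \<inter> F' = {}"
    proof -
      \<comment> \<open>Tree edges of \<open>S\<close> stay in \<open>S\<close>, and
        \<open>w\<close> lies in the other half of the vertices.\<close>
      have "e \<inter> S' = {}" if "e \<in> F" for e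
      proof (cases "e = {vtx S 0, w}")
        case True
        have "vtx S 0 \<in> S" using vtx_in[OF S(6), of 0] S(2) \<open>1 \<le> k\<close> by simp
        then show ?thesis using True disj S'(7) by auto
      next
        case False
        then show ?thesis using limb_edges_subset[OF S(6)] that disj unfolding F_def by blast
      qed
      then show ?thesis using FM(2) unfolding M'_def touching_def by blast
    qed
    then have cFF: "card (F \<union> F') = 2 * k" using fF cF by (simp add: card_Un_disjoint)
    define N where "N = (n choose 2) - ((n - k) choose 2)"
    have cM: "card M = N" "card M' = N" unfolding M_def M'_def A_def N_def
      using card_touching_all_edges S S' by auto
    have "card (M \<inter> M') \<le> k\<^sup>2"
      using card_touching_Int_le[OF S(6) S'(6) disj] S S'
      unfolding M_def M'_def A_def by (simp add: power2_eq_square)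
    moreover have "card M + card M' = card (M \<union> M') + card (M \<inter> M')"
      using card_Un_Int[OF fM] .
    ultimately have cMM: "2 * N \<le> card (M \<union> M') + k\<^sup>2" using cM by simp
    \<comment> \<open>This bound and the next keep the natural-number subtractions in the exponents
      exact.\<close>
    have kN: "k \<le> N" using card_mono[OF fM(1) FM(1)] cF cM by simp
    have kMM: "2 * k \<le> card (M \<union> M')"
      unfolding cFF[symmetric] using fM FM by (intro card_mono Un_mono) simp_all
    have "gnp_prob n p (\<lambda>E. is_limb par E S w \<and> is_limb par E S' w')
      \<le> gnp_prob n p (\<lambda>E. E \<inter> (M \<union> M') = F \<union> F')"
    proof (rule gnp_prob_mono)
      fix E assume "E \<subseteq> all_edges {0..<n}" and *: "is_limb par E S w \<and> is_limb par E S' w'"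
      then have "E \<inter> M = F" "E \<inter> M' = F'"
        unfolding is_limb_def M_def M'_def F_def F'_def A_def
        using touching_Int[of E "all_edges {0..<n}"] by auto
      then show "E \<inter> (M \<union> M') = F \<union> F'" by auto
    qed (use assms in auto)
    also have "\<dots> = p ^ (2 * k) * (1 - p) ^ (card (M \<union> M') - 2 * k)"
      unfolding cFF[symmetric]
      by (rule gnp_prob_cylinder[OF Un_least[OF MA[unfolded A_def]] Un_mono[OF FM]])
    also have "\<dots> \<le> (limb_prob n p k)\<^sup>2 / (1 - p) ^ (k\<^sup>2)"
    proof -
      have "(1 - p) ^ (card (M \<union> M') - 2 * k) * (1 - p) ^ (k\<^sup>2)
          = (1 - p) ^ (card (M \<union> M') - 2 * k + k\<^sup>2)" by (simp add: power_add)
      also have "\<dots> \<le> (1 - p) ^ (2 * (N - k))"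
        using assms cMM kMM kN by (intro power_decreasing) auto
      finally have "p ^ (2 * k) * ((1 - p) ^ (card (M \<union> M') - 2 * k) * (1 - p) ^ (k\<^sup>2))
          \<le> p ^ (2 * k) * (1 - p) ^ (2 * (N - k))"
        using assms by (intro mult_left_mono) auto
      also have "\<dots> = (limb_prob n p k)\<^sup>2"
        unfolding limb_prob_def N_def[symmetric] by (simp add: power_mult_distrib power_mult[symmetric] mult.commute)
      finally show ?thesis using assms by (simp add: pos_le_divide_eq mult.assoc)
    qed
    finally show ?thesis unfolding iS jS by simp
  qed
qed

lemma expect_limb_count:
  assumes "1 \<le> k"
  shows "gnp_expect n p (\<lambda>E. real (limb_count par n k E)) = limb_mean n p k"
  unfolding limb_count_eq_sum gnp_expect_sum limb_mean_def
  using gnp_prob_is_limb[OF _ assms] by (simp add: gnp_prob_eq_expect)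

lemma expect_limb_count_square:
  assumes "1 \<le> k" "0 < p" "p < 1"
  shows "gnp_expect n p (\<lambda>E. (real (limb_count par n k E))\<^sup>2)
    \<le> limb_mean n p k + (limb_mean n p k)\<^sup>2 / (1 - p) ^ (k\<^sup>2)"
proof -
  let ?I = "limb_index n k"
  define q where "q = limb_prob n p k"
  define c where "c = q\<^sup>2 / (1 - p) ^ (k\<^sup>2)"
  have q0: "0 \<le> q" "0 \<le> c" unfolding q_def limb_prob_def c_def using assms by auto
  let ?P = "\<lambda>i E. is_limb par E (fst i) (snd i)"
  have "gnp_expect n p (\<lambda>E. (real (limb_count par n k E))\<^sup>2)
     = gnp_expect n p (\<lambda>E. \<Sum>i\<in>?I. \<Sum>j\<in>?I. of_bool (?P i E \<and> ?P j E))"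
    unfolding limb_count_eq_sum power2_eq_square sum_product of_bool_conj ..
  also have "\<dots> = (\<Sum>i\<in>?I. \<Sum>j\<in>?I. gnp_prob n p (\<lambda>E. ?P i E \<and> ?P j E))"
    unfolding gnp_expect_sum gnp_prob_eq_expect ..
  \<comment> \<open>Diagonal terms also receive \<open>c\<close>, so that the double sum evaluates
    without separating them.\<close>
  also have "\<dots> \<le> (\<Sum>i\<in>?I. \<Sum>j\<in>?I. (if j = i then q else 0) + c)"
  proof (intro sum_mono)
    fix i j assume "i \<in> ?I" "j \<in> ?I"
    then show "gnp_prob n p (\<lambda>E. ?P i E \<and> ?P j E) \<le> (if j = i then q else 0) + c"
      using gnp_prob_is_limb[of i n k p] gnp_prob_two_limbs[of i n k j p] assms q0
      unfolding q_def c_def by (cases "j = i") auto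
  qed
  also have "\<dots> = real (card ?I) * q + (real (card ?I) * real (card ?I)) * c"
    by (simp add: sum.distrib distrib_left)
  also have "\<dots> = limb_mean n p k + (limb_mean n p k)\<^sup>2 / (1 - p) ^ (k\<^sup>2)"
    unfolding limb_mean_def q_def[symmetric] c_def by (simp add: power2_eq_square)
  finally show ?thesis .
qed

text \<open>Chebyshev: with \<open>m\<close> the mean, the variance is at most
  \<open>m + m\<^sup>2 * (1 / (1 - p) ^ (k\<^sup>2) - 1)\<close>, and the event is a deviation of at
  least \<open>m / 2\<close>.\<close>

lemma limb_count_concentration:
  assumes "1 \<le> k" "0 < p" "p < 1" "0 < limb_mean n p k"
  shows "gnp_prob n p (\<lambda>E. real (limb_count par n k E) \<le> limb_mean n p k / 2)
    \<le> 4 / limb_mean n p k + 4 * (1 / (1 - p) ^ (k\<^sup>2) - 1)"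
proof -
  define m where "m = limb_mean n p k"
  let ?X = "\<lambda>E. real (limb_count par n k E)"
  have m: "m > 0" using assms m_def by simp
  \<comment> \<open>The square of \<open>m - ?X E\<close> is written out so that linearity applies
    term by term.\<close>
  have "gnp_prob n p (\<lambda>E. ?X E \<le> m / 2)
      \<le> gnp_expect n p (\<lambda>E. 4 / m\<^sup>2 * ((?X E)\<^sup>2 + ((- 2 * m) * ?X E + m\<^sup>2)))"
    unfolding gnp_prob_eq_expect
  proof (rule gnp_expect_mono)
    fix E
    have eq: "(?X E)\<^sup>2 + ((- 2 * m) * ?X E + m\<^sup>2) = (m - ?X E)\<^sup>2"
      by (simp add: power2_eq_square algebra_simps)
    show "of_bool (?X E \<le> m / 2) \<le> 4 / m\<^sup>2 * ((?X E)\<^sup>2 + ((- 2 * m) * ?X E + m\<^sup>2))"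
    proof (cases "?X E \<le> m / 2")
      case True
      then have "(m / 2)\<^sup>2 \<le> (m - ?X E)\<^sup>2" using m by (intro power_mono) auto
      then show ?thesis unfolding eq using True m by (simp add: field_simps power2_eq_square)
    qed (simp only: eq, simp)
  qed (use assms in auto)
  also have "\<dots> = 4 / m\<^sup>2 * (gnp_expect n p (\<lambda>E. (?X E)\<^sup>2) + ((- 2 * m) * m + m\<^sup>2))"
    unfolding gnp_expect_cmult gnp_expect_add gnp_expect_const
      expect_limb_count[OF assms(1)] m_def[symmetric] ..
  also have "\<dots> \<le> 4 / m\<^sup>2 * ((m + m\<^sup>2 / (1 - p) ^ (k\<^sup>2)) + ((- 2 * m) * m + m\<^sup>2))"
    using expect_limb_count_square[OF assms(1-3), of n] unfolding m_def[symmetric]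
    by (intro mult_left_mono add_right_mono) auto
  also have "\<dots> = 4 / m + 4 * (1 / (1 - p) ^ (k\<^sup>2) - 1)"
    using m by (simp add: field_simps power2_eq_square)
  finally show ?thesis unfolding m_def .
qed

end

section \<open>Moving a limb to a largest component\<close>

definition edge_closed :: "nat set set \<Rightarrow> nat set \<Rightarrow> bool" where
  "edge_closed E A \<longleftrightarrow> (\<forall>e\<in>E. e \<inter> A \<noteq> {} \<longrightarrow> e \<subseteq> A)"

text \<open>Connected components are handled as the minimal nonempty edge-closed vertex sets.\<close>

definition is_component :: "nat set set \<Rightarrow> nat set \<Rightarrow> bool" where
  "is_component E C \<longleftrightarrow> C \<noteq> {} \<and> edge_closed E C \<and>
     (\<forall>A. edge_closed E A \<longrightarrow> A \<inter> C \<noteq> {} \<longrightarrow> C \<subseteq> A)"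

lemma edge_closedD: "edge_closed E A \<Longrightarrow> e \<in> E \<Longrightarrow> x \<in> e \<Longrightarrow> x \<in> A \<Longrightarrow> y \<in> e \<Longrightarrow> y \<in> A"
  unfolding edge_closed_def by blast

lemma is_component_minimal:
  "is_component E C \<Longrightarrow> edge_closed E A \<Longrightarrow> x \<in> A \<Longrightarrow> x \<in> C \<Longrightarrow> C \<subseteq> A"
  unfolding is_component_def by blast

lemma is_component_closed: "is_component E C \<Longrightarrow> edge_closed E C"
  unfolding is_component_def by blast

text \<open>Bridge from reachability to minimal closed sets: closed sets are stable under walks and
  walks are reversible, so a closed set meeting the class of \<open>v\<close> contains all of
  it.\<close>

lemma component_of_is_component:
  assumes "v \<in> V" "E \<subseteq> all_edges V"
  shows "is_component E (component_of V E v)" "v \<in> component_of V E v" "component_of V E v \<subseteq> V"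
proof -
  let ?R = "\<lambda>x y. {x, y} \<in> E"
  let ?C = "component_of V E v"
  show v: "v \<in> ?C" using assms(1) unfolding component_of_def by auto
  show "?C \<subseteq> V" unfolding component_of_def by auto
  have cl: "edge_closed E ?C" unfolding edge_closed_def
  proof (intro ballI impI)
    fix e assume e: "e \<in> E" "e \<inter> ?C \<noteq> {}"
    then obtain x where x: "x \<in> e" "x \<in> ?C" by auto
    have "card e = 2" "e \<subseteq> V" using e(1) assms(2) unfolding all_edges_def by auto
    then obtain y where y: "e = {x, y}" using x(1) by (auto simp: card_2_iff)
    have "?R\<^sup>*\<^sup>* v x" using x(2) unfolding component_of_def by simp
    moreover have "?R x y" using e(1) y by simp
    ultimately have "?R\<^sup>*\<^sup>* v y" by (rule rtranclp.rtrancl_into_rtrancl)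
    then show "e \<subseteq> ?C" using x y \<open>e \<subseteq> V\<close> unfolding component_of_def by auto
  qed
  have reach: "w \<in> A" if "edge_closed E A" "x \<in> A" "?R\<^sup>*\<^sup>* x w" for A x w
    using that(3,2)
  proof (induction rule: rtranclp_induct)
    case (step y z)
    show ?case by (rule edge_closedD[OF that(1) step.hyps(2), of y]) (use step in auto)
  qed
  have sym: "?R\<^sup>*\<^sup>* w x" if "?R\<^sup>*\<^sup>* x w" for x w
    using that
  proof (induction rule: rtranclp_induct)
    case (step y z)
    then have "?R z y" by (simp add: insert_commute)
    then show ?case using step.IH by (rule converse_rtranclp_into_rtranclp)
  qed simp
  have "?C \<subseteq> A" if A: "edge_closed E A" "A \<inter> ?C \<noteq> {}" for A
  proof
    fix w assume "w \<in> ?C"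
    obtain x where x: "x \<in> A" "x \<in> ?C" using A(2) by auto
    have "?R\<^sup>*\<^sup>* x v" "?R\<^sup>*\<^sup>* v w"
      using x(2) \<open>w \<in> ?C\<close> sym[of v x] unfolding component_of_def by auto
    then have "?R\<^sup>*\<^sup>* x w" by (rule rtranclp_trans)
    then show "w \<in> A" using reach A(1) x(1) by blast
  qed
  then show "is_component E ?C" unfolding is_component_def using v cl by blast
qed

lemma components_is_component:
  assumes "C \<in> components V E" "E \<subseteq> all_edges V"
  shows "is_component E C" "C \<subseteq> V"
proof -
  obtain v where "v \<in> V" "C = component_of V E v" using assms(1) unfolding components_def by auto
  then show "is_component E C" "C \<subseteq> V" using component_of_is_component[OF _ assms(2)] by auto
qed

context parent_tree
begin

lemma limb_subset_closed:
  assumes "finite S" "tree_edges par S \<subseteq> E" "edge_closed E A" "x \<in> S" "x \<in> A"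
  shows "S \<subseteq> A"
proof (rule ccontr)
  assume "\<not> S \<subseteq> A"
  then obtain e where "e \<in> tree_edges par S" "e \<inter> A \<noteq> {}" "\<not> e \<subseteq> A"
    using tree_edge_crossing[OF assms(1)] assms(4,5) by blast
  then show False using assms(2,3) unfolding edge_closed_def by blast
qed

lemma limb_root_edge: "is_limb par E S w \<Longrightarrow> {vtx S 0, w} \<in> E"
  unfolding is_limb_def limb_edges_def touching_def by blast

text \<open>Neither \<open>S\<close> nor \<open>w\<close> is tied to \<open>limb_index\<close>: the
  limb to be excluded in \<open>move_limb_inj\<close> may hang from a vertex of either half.\<close>

definition limbless :: "nat \<Rightarrow> nat set set \<Rightarrow> nat set \<Rightarrow> bool" where
  "limbless k E C \<longleftrightarrow> \<not> (\<exists>S w. S \<subseteq> C \<and> card S = k \<and> w \<notin> S \<and> is_limb par E S w)"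

definition move_limb :: "nat set set \<Rightarrow> nat set \<Rightarrow> nat \<Rightarrow> nat \<Rightarrow> nat set set" where
  "move_limb E S w w' = insert {vtx S 0, w'} (E - {{vtx S 0, w}})"

end

section \<open>One move and its effect on the components\<close>

locale limb_move = parent_tree +
  fixes n k :: nat and E S w C w'
  assumes E: "E \<subseteq> all_edges {0..<n}"
    and S: "S \<subseteq> {0..<n}" "card S = k" and k: "1 \<le> k"
    and w: "w < n" "w \<notin> S" and limb: "is_limb par E S w"
    and C: "C \<in> largest_components {0..<n} E" "limbless k E C" and w': "w' \<in> C"
begin

abbreviation "r \<equiv> vtx S 0"
abbreviation "E' \<equiv> move_limb E S w w'"

lemma fS: "finite S" using S(1) finite_subset by auto

lemma r_in: "r \<in> S" using vtx_in[OF fS, of 0] S(2) k by simp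

lemma C_comp: "is_component E C" "C \<subseteq> {0..<n}" "edge_closed E C"
  using C(1) components_is_component[OF _ E] is_component_closed
  unfolding largest_components_def by auto

lemma tree_in_E: "tree_edges par S \<subseteq> E" using is_limb_tree_edge[OF limb] by auto

text \<open>The tree is connected, so a limb meeting \<open>C\<close> would lie inside
  \<open>C\<close>, against \<open>limbless\<close>.\<close>

lemma S_disjoint: "S \<inter> C = {}"
proof (rule ccontr)
  assume "S \<inter> C \<noteq> {}"
  then have "S \<subseteq> C" using limb_subset_closed[OF fS tree_in_E C_comp(3)] by blast
  then show False using C(2) S(2) w(2) limb unfolding limbless_def by blast
qed

lemma w_notin: "w \<notin> C"
  using edge_closedD[OF C_comp(3) limb_root_edge[OF limb], of w r] r_in S_disjoint by blast

lemma w'_notin: "w' \<notin> S" using w' S_disjoint by auto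

lemma edges: "{r, w} \<in> E" "{r, w'} \<notin> E" "{r, w} \<noteq> {r, w'}" "{r, w'} \<in> all_edges {0..<n}"
proof -
  show "{r, w} \<in> E" by (rule limb_root_edge[OF limb])
  have "w \<noteq> w'" using w_notin w' by auto
  then show "{r, w} \<noteq> {r, w'}" by (auto simp: doubleton_eq_iff)
  have "{r, w'} \<notin> E" if "{r, w'} \<in> E"
    using edge_closedD[OF C_comp(3) that, of w' r] w' r_in S_disjoint by blast
  then show "{r, w'} \<notin> E" by blast
  show "{r, w'} \<in> all_edges {0..<n}"
    using r_in S(1) w' C_comp(2) w'_notin by (auto simp: all_edges_iff)
qed

lemma E'_subset: "E' \<subseteq> all_edges {0..<n}"
  unfolding move_limb_def using E edges(4) by auto

lemma card_E': "card E' = card E"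
proof -
  have fE: "finite E" using E finite_subset by fastforce
  have "card E' = Suc (card (E - {{r, w}}))"
    unfolding move_limb_def using fE edges(2) by (subst card_insert_disjoint) auto
  also have "\<dots> = card E" by (rule card.remove[OF fE edges(1), symmetric])
  finally show ?thesis .
qed

text \<open>The inverse of the move: the new graph together with \<open>S\<close>, \<open>w\<close>
  and \<open>w'\<close> gives back the old one, as injectivity needs.\<close>

lemma E_eq: "E = insert {r, w} (E' - {{r, w'}})"
  unfolding move_limb_def using edges by auto

lemma limb': "is_limb par E' S w'"
proof -
  have "touching E S = insert {r, w} (tree_edges par S)"
    using limb unfolding is_limb_def limb_edges_def .
  moreover have "{r, w} \<notin> tree_edges par S" using tree_edges_subset[OF fS] w(2) by blast
  moreover have "touching E' S = insert {r, w'} (touching E S - {{r, w}})"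
    unfolding touching_def move_limb_def using r_in by auto
  ultimately show ?thesis unfolding is_limb_def limb_edges_def by auto
qed

lemma tree_in_E': "tree_edges par S \<subseteq> E'" using is_limb_tree_edge[OF limb'] by auto

text \<open>Closed, since the only exit of the rehung limb leads to \<open>w'\<close>; minimal,
  since the move deletes no edge inside \<open>C\<close> and \<open>{r, w'}\<close> links the two
  parts.\<close>

lemma comp': "is_component E' (C \<union> S)"
proof -
  have cl: "edge_closed E' (C \<union> S)" unfolding edge_closed_def
  proof (intro ballI impI)
    fix e assume e: "e \<in> E'" "e \<inter> (C \<union> S) \<noteq> {}"
    show "e \<subseteq> C \<union> S"
    proof (cases "e \<inter> S = {}")
      case True
      then have "e \<in> E" using e(1) r_in unfolding move_limb_def by auto
      moreover have "e \<inter> C \<noteq> {}" using e(2) True by auto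
      ultimately show ?thesis using C_comp(3) unfolding edge_closed_def by blast
    next
      case False
      then have "e \<in> limb_edges par S w'"
        using limb' e(1) unfolding is_limb_def touching_def by auto
      then show ?thesis using limb_edges_subset[OF fS] r_in w' by blast
    qed
  qed
  moreover have "C \<union> S \<subseteq> A" if A: "edge_closed E' A" "A \<inter> (C \<union> S) \<noteq> {}" for A
  proof -
    have SA: "S \<subseteq> A" if "x \<in> S" "x \<in> A" for x
      using limb_subset_closed[OF fS tree_in_E' A(1)] that by blast
    have rw': "{r, w'} \<in> E'" unfolding move_limb_def by simp
    have CA: "C \<subseteq> A" if "x \<in> C" "x \<in> A" for x
    proof -
      \<comment> \<open>The deleted edge has its end \<open>w\<close> outside \<open>C\<close>, so
        the old edges inside \<open>C\<close> all survive, and the minimality of \<open>C\<close> in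
        the old graph applies.\<close>
      have "edge_closed E (A \<inter> C)" unfolding edge_closed_def
      proof (intro ballI impI)
        fix e assume e: "e \<in> E" "e \<inter> (A \<inter> C) \<noteq> {}"
        then have eC: "e \<subseteq> C" using C_comp(3) unfolding edge_closed_def by blast
        then have "e \<in> E'" using e(1) w_notin unfolding move_limb_def by auto
        then have "e \<subseteq> A" using A(1) e(2) unfolding edge_closed_def by blast
        then show "e \<subseteq> A \<inter> C" using eC by auto
      qed
      then show ?thesis using is_component_minimal[OF C_comp(1)] that by blast
    qed
    obtain x where x: "x \<in> A" "x \<in> C \<union> S" using A(2) by auto
    show ?thesis
    proof (cases "x \<in> C")
      case True
      then have "C \<subseteq> A" using CA x by blast
      moreover from this have "r \<in> A" using edge_closedD[OF A(1) rw', of w' r] w' by auto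
      ultimately show ?thesis using SA r_in by blast
    next
      case False
      then have "S \<subseteq> A" using SA x by blast
      moreover from this have "w' \<in> A" using edge_closedD[OF A(1) rw', of r w'] r_in by auto
      ultimately show ?thesis using CA w' by blast
    qed
  qed
  ultimately show ?thesis unfolding is_component_def using w' by blast
qed

lemma card_comp': "card (C \<union> S) = card C + k"
proof -
  have "finite C" using C_comp(2) finite_subset by auto
  then show ?thesis using fS S_disjoint S(2) by (subst card_Un_disjoint) auto
qed

text \<open>Away from \<open>C \<union> S\<close> a move only deletes edges, so \<open>K\<close>
  lies inside an old component, which is no larger than \<open>C\<close>. With
  \<open>card_comp'\<close> this makes \<open>C \<union> S\<close> the unique largest
  component.\<close>

lemma other_component_small:
  assumes K: "is_component E' K" "K \<subseteq> {0..<n}" "K \<noteq> C \<union> S"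
  shows "card K \<le> card C"
proof -
  have disj: "K \<inter> (C \<union> S) = {}"
  proof (rule ccontr)
    assume "K \<inter> (C \<union> S) \<noteq> {}"
    then have "K \<subseteq> C \<union> S" "C \<union> S \<subseteq> K"
      using is_component_minimal[OF K(1) is_component_closed[OF comp']]
        is_component_minimal[OF comp' is_component_closed[OF K(1)]] by blast+
    then show False using K(3) by auto
  qed
  obtain v where v: "v \<in> K" using K(1) unfolding is_component_def by auto
  then have vn: "v \<in> {0..<n}" using K(2) by auto
  define A where "A = component_of {0..<n} E v"
  have A: "is_component E A" "v \<in> A" "A \<subseteq> {0..<n}"
    using component_of_is_component[OF vn E] unfolding A_def by auto
  have "edge_closed E' (A \<inter> K)" unfolding edge_closed_def
  proof (intro ballI impI)
    fix e assume e: "e \<in> E'" "e \<inter> (A \<inter> K) \<noteq> {}"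
    then have eK: "e \<subseteq> K" using is_component_closed[OF K(1)] unfolding edge_closed_def by blast
    then have "e \<noteq> {r, w'}" using r_in disj by auto
    then have "e \<in> E" using e(1) unfolding move_limb_def by auto
    then have "e \<subseteq> A" using is_component_closed[OF A(1)] e(2) unfolding edge_closed_def by blast
    then show "e \<subseteq> A \<inter> K" using eK by auto
  qed
  then have "K \<subseteq> A" using is_component_minimal[OF K(1)] v A(2) by blast
  then have "card K \<le> card A" using A(3) finite_subset by (intro card_mono) auto
  also have "card A \<le> card C"
    using C(1) vn unfolding largest_components_def A_def components_def by auto
  finally show ?thesis .
qed

end

section \<open>Injectivity of the move\<close>

context parent_tree
begin

text \<open>Overlapping limbs attach to each other by \<open>is_limb_crossing\<close>. If disjoint
  limbs had \<open>w \<in> S'\<close>, the root edge of \<open>S\<close> would leave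
  \<open>S'\<close> and hence be the root edge of \<open>S'\<close> as well, again a mutual
  attachment.\<close>

lemma limbs_disjoint:
  assumes "finite S" "finite S'" "card S = k" "card S' = k" "1 \<le> k" "S \<noteq> S'"
    and "is_limb par E S w" "is_limb par E S' w'"
    and "is_component E K" "2 * k < card K" "S \<subseteq> K"
  shows "S \<inter> S' = {}" "w \<notin> S'"
proof -
  have r: "vtx S 0 \<in> S" "vtx S' 0 \<in> S'"
    using vtx_in[OF assms(1), of 0] vtx_in[OF assms(2), of 0] assms by auto
  \<comment> \<open>Mutually attached limbs have no exit, so their union, with at most
    \<open>2 * k\<close> vertices, would contain \<open>K\<close>.\<close>
  have *: "\<not> (w \<in> S' \<and> w' \<in> S)"
  proof
    assume ww: "w \<in> S' \<and> w' \<in> S"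
    have "edge_closed E (S \<union> S')" unfolding edge_closed_def
    proof (intro ballI impI)
      fix e assume "e \<in> E" "e \<inter> (S \<union> S') \<noteq> {}"
      then have "e \<in> limb_edges par S w \<or> e \<in> limb_edges par S' w'"
        using assms(7,8) unfolding is_limb_def touching_def by blast
      then show "e \<subseteq> S \<union> S'"
        using limb_edges_subset[OF assms(1)] limb_edges_subset[OF assms(2)] r ww by blast
    qed
    then have "K \<subseteq> S \<union> S'" using is_component_minimal[OF assms(9)] r assms(11) by blast
    then have "card K \<le> card (S \<union> S')" using assms by (intro card_mono) auto
    also have "\<dots> \<le> 2 * k" using card_Un_le[of S S'] assms by simp
    finally show False using assms by simp
  qed
  show disj: "S \<inter> S' = {}"
  proof (rule ccontr)
    assume "S \<inter> S' \<noteq> {}"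
    then have "w' \<in> S" "w \<in> S'"
      using is_limb_crossing[of S S' E w w'] is_limb_crossing[of S' S E w' w] assms by auto
    then show False using * by blast
  qed
  show "w \<notin> S'"
  proof
    assume w: "w \<in> S'"
    have "{vtx S 0, w} \<in> touching E S'"
      using limb_root_edge[OF assms(7)] w unfolding touching_def by auto
    then have "{vtx S 0, w} \<in> limb_edges par S' w'" using assms(8) unfolding is_limb_def by auto
    moreover have "\<not> {vtx S 0, w} \<subseteq> S'" using r disj by auto
    ultimately have "{vtx S 0, w} = {vtx S' 0, w'}" using limb_edges_subset[OF assms(2)] by blast
    then have "w' \<in> S" using r disj by (auto simp: doubleton_eq_iff)
    then show False using * w by blast
  qed
qed

text \<open>The new graph reveals its unique largest component, and the moved limb is identified
  inside it: a second one would be disjoint from it and already present before the move. By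
  \<open>big\<close> this component has more than \<open>2 * k\<close> vertices, as
  \<open>limbs_disjoint\<close> requires.\<close>

lemma move_limb_inj:
  assumes m1: "limb_move par n k E1 S1 w C1 w1" and m2: "limb_move par n k E2 S2 w C2 w2"
    and big: "k < card C1" and eq: "move_limb E1 S1 w w1 = move_limb E2 S2 w w2"
  shows "E1 = E2 \<and> S1 = S2 \<and> w1 = w2"
proof -
  interpret m1: limb_move par n k E1 S1 w C1 w1 by (rule m1)
  interpret m2: limb_move par n k E2 S2 w C2 w2 by (rule m2)
  let ?E' = "move_limb E1 S1 w w1"
  \<comment> \<open>Otherwise \<open>card C2 + k \<le> card C1\<close> and
    \<open>card C1 + k \<le> card C2\<close>.\<close>
  have K: "C1 \<union> S1 = C2 \<union> S2"
  proof (rule ccontr)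
    assume neq: "C1 \<union> S1 \<noteq> C2 \<union> S2"
    have "card (C2 \<union> S2) \<le> card C1"
      by (rule m1.other_component_small) (use m2.comp' eq m2.C_comp(2) m2.S(1) neq in auto)
    moreover have "card (C1 \<union> S1) \<le> card C2"
      by (rule m2.other_component_small) (use m1.comp' eq m1.C_comp(2) m1.S(1) neq in auto)
    ultimately show False using m1.card_comp' m2.card_comp' m1.k by simp
  qed
  have l2: "is_limb par ?E' S2 w2" using m2.limb' eq by simp
  have "S1 = S2"
  proof (rule ccontr)
    assume neq: "S1 \<noteq> S2"
    have d: "S1 \<inter> S2 = {}" "w1 \<notin> S2"
      using limbs_disjoint[OF m1.fS m2.fS m1.S(2) m2.S(2) m1.k neq m1.limb' l2 m1.comp']
        m1.card_comp' big by auto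
    have S2C1: "S2 \<subseteq> C1" using K d(1) by auto
    have "w \<notin> S2" using S2C1 m1.w_notin by auto
    \<comment> \<open>Neither the deleted nor the added edge has an end in \<open>S2\<close>, so
      \<open>S2\<close> was already a limb inside \<open>C1\<close>.\<close>
    have "touching E1 S2 = touching ?E' S2"
      unfolding touching_def move_limb_def using d \<open>w \<notin> S2\<close> m1.r_in by auto
    then have "is_limb par E1 S2 w2" using l2 unfolding is_limb_def by simp
    then show False using m1.C(2) S2C1 m2.S(2) m2.w'_notin unfolding limbless_def by blast
  qed
  moreover have "w1 = w2"
    using limb_edges_attach_inj[OF m1.fS m1.w'_notin] m1.limb' l2 m2.w'_notin \<open>S1 = S2\<close>
    unfolding is_limb_def by auto
  moreover have "E1 = E2" using m1.E_eq m2.E_eq eq \<open>S1 = S2\<close> \<open>w1 = w2\<close> by simp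
  ultimately show ?thesis by blast
qed

end

section \<open>Godsil--McKay switching\<close>

text \<open>Read as matrices, the conditions are \<open>A * Q = Q * A'\<close> and
  \<open>Q * Q = 1\<close>, so \<open>A = Q * A' * Q\<close> is similar to \<open>A'\<close>. Sums
  over \<open>V\<close> keep the enumeration of the vertices out of later arguments.\<close>

lemma cospectral_of_intertwining:
  fixes P :: "nat \<Rightarrow> nat \<Rightarrow> real"
  assumes "finite V"
    and comm: "\<And>x z. x \<in> V \<Longrightarrow> z \<in> V \<Longrightarrow>
      (\<Sum>y\<in>V. of_bool ({x, y} \<in> E) * P y z) = (\<Sum>y\<in>V. P x y * of_bool ({y, z} \<in> E'))"
    and invol: "\<And>x z. x \<in> V \<Longrightarrow> z \<in> V \<Longrightarrow> (\<Sum>y\<in>V. P x y * P y z) = of_bool (x = z)"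
  shows "cospectral V E V E'"
proof -
  define m where "m = card V"
  define xs where "xs = sorted_list_of_set V"
  have bij: "bij_betw ((!) xs) {0..<m} V"
    unfolding xs_def m_def using bij_betw_vtx[OF assms(1)]
    by (simp add: vtx_def[abs_def])
  have inV: "xs ! i \<in> V" if "i < m" for i using bij that by (auto simp: bij_betw_def)
  have inj: "xs ! i = xs ! j \<longleftrightarrow> i = j" if "i < m" "j < m" for i j
    using bij that by (auto simp: bij_betw_def inj_on_def)
  have sum_xs: "(\<Sum>l = 0..<m. g (xs ! l)) = (\<Sum>y\<in>V. g y)" for g :: "nat \<Rightarrow> real"
    using sum.reindex_bij_betw[OF bij] .
  define Q where "Q = mat m m (\<lambda>(i, j). P (xs ! i) (xs ! j))"
  define A where "A = adj_mat V E"
  define A' where "A' = adj_mat V E'"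
  have A: "A = mat m m (\<lambda>(i, j). of_bool ({xs ! i, xs ! j} \<in> E))"
    and A': "A' = mat m m (\<lambda>(i, j). of_bool ({xs ! i, xs ! j} \<in> E'))"
    unfolding A_def A'_def adj_mat_def Let_def m_def xs_def of_bool_def by simp_all
  have carr: "Q \<in> carrier_mat m m" "A \<in> carrier_mat m m" "A' \<in> carrier_mat m m"
    unfolding Q_def A A' by auto
  have QQ: "Q * Q = 1\<^sub>m m"
  proof (rule eq_matI)
    fix i j assume ij: "i < dim_row (1\<^sub>m m :: real mat)" "j < dim_col (1\<^sub>m m :: real mat)"
    then have "(Q * Q) $$ (i, j) = (\<Sum>l = 0..<m. P (xs ! i) (xs ! l) * P (xs ! l) (xs ! j))"
      unfolding Q_def by (simp add: scalar_prod_def)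
    also have "\<dots> = of_bool (i = j)"
      using sum_xs[of "\<lambda>y. P (xs ! i) y * P y (xs ! j)"] invol[OF inV inV] inj ij by simp
    finally show "(Q * Q) $$ (i, j) = 1\<^sub>m m $$ (i, j)" using ij by simp
  qed (simp_all add: Q_def)
  have AQ: "A * Q = Q * A'"
  proof (rule eq_matI)
    fix i j assume "i < dim_row (Q * A')" "j < dim_col (Q * A')"
    then have ij: "i < m" "j < m" using carr by auto
    then have "(A * Q) $$ (i, j) = (\<Sum>l = 0..<m. of_bool ({xs ! i, xs ! l} \<in> E) * P (xs ! l) (xs ! j))"
      unfolding Q_def A by (simp add: scalar_prod_def)
    also have "\<dots> = (\<Sum>y\<in>V. of_bool ({xs ! i, y} \<in> E) * P y (xs ! j))" by (rule sum_xs)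
    also have "\<dots> = (\<Sum>y\<in>V. P (xs ! i) y * of_bool ({y, xs ! j} \<in> E'))"
      by (rule comm[OF inV inV]) fact+
    also have "\<dots> = (\<Sum>l = 0..<m. P (xs ! i) (xs ! l) * of_bool ({xs ! l, xs ! j} \<in> E'))"
      by (rule sum_xs[symmetric])
    also have "\<dots> = (Q * A') $$ (i, j)" using ij unfolding Q_def A' by (simp add: scalar_prod_def)
    finally show "(A * Q) $$ (i, j) = (Q * A') $$ (i, j)" .
  qed (use carr in auto)
  have "Q * A' * Q = A * (Q * Q)" unfolding AQ[symmetric] using carr by simp
  then have "A = Q * A' * Q" unfolding QQ using carr by simp
  then have "similar_mat_wit A A' Q Q"
    unfolding similar_mat_wit_def using carr QQ by (auto simp: Let_def)
  then have "similar_mat A A'" unfolding similar_mat_def by blast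
  then show ?thesis unfolding cospectral_def A_def A'_def by (rule char_poly_similar)
qed

definition gm_half :: "nat set \<Rightarrow> nat set set \<Rightarrow> nat set \<Rightarrow> nat set" where
  "gm_half V E D = {x \<in> V - D. 2 * card {y \<in> D. {x, y} \<in> E} = card D}"

definition cross_edges :: "nat set \<Rightarrow> nat set \<Rightarrow> nat set set" where
  "cross_edges A B = {{x, y} | x y. x \<in> A \<and> y \<in> B}"

definition gm_switch :: "nat set \<Rightarrow> nat set set \<Rightarrow> nat set \<Rightarrow> nat set set" where
  "gm_switch V E D = (E - cross_edges (gm_half V E D) D) \<union> (cross_edges (gm_half V E D) D - E)"

text \<open>The Godsil-McKay condition for a single switching set; doubling the count expresses one
  half without division.\<close>

definition gm_admissible :: "nat set \<Rightarrow> nat set set \<Rightarrow> nat set \<Rightarrow> bool" where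
  "gm_admissible V E D \<longleftrightarrow>
     (\<exists>d. \<forall>x\<in>D. card {y \<in> D. {x, y} \<in> E} = d) \<and>
     (\<forall>x\<in>V - D. card {y \<in> D. {x, y} \<in> E} \<in> {0, card D} \<or> 2 * card {y \<in> D. {x, y} \<in> E} = card D)"

lemma cross_edges_iff:
  assumes "A \<inter> B = {}"
  shows "{x, y} \<in> cross_edges A B \<longleftrightarrow> x \<in> A \<and> y \<in> B \<or> y \<in> A \<and> x \<in> B"
  unfolding cross_edges_def by (auto simp: doubleton_eq_iff)

lemma gm_half_disjoint: "gm_half V E D \<inter> D = {}"
  unfolding gm_half_def by auto

lemma gm_switch_iff:
  "{x, y} \<in> gm_switch V E D \<longleftrightarrow>
    (if x \<in> gm_half V E D \<and> y \<in> D \<or> y \<in> gm_half V E D \<and> x \<in> D then {x, y} \<notin> E else {x, y} \<in> E)"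
  unfolding gm_switch_def using cross_edges_iff[OF gm_half_disjoint, of x y V E D] by auto

lemma gm_switch_subset:
  assumes "D \<subseteq> V" "E \<subseteq> all_edges V"
  shows "gm_switch V E D \<subseteq> all_edges V"
proof -
  have "cross_edges (gm_half V E D) D \<subseteq> all_edges V"
    using assms(1) unfolding cross_edges_def gm_half_def by (auto simp: all_edges_iff)
  then show ?thesis using assms(2) unfolding gm_switch_def by auto
qed

text \<open>The symmetric orthogonal matrix of Godsil--McKay switching is the identity outside
  the switching set and \<open>2J/m - I\<close> on the switching set of size \<open>m\<close>.\<close>

theorem gm_switch_cospectral:
  assumes V: "finite V" "D \<subseteq> V" "D \<noteq> {}" and adm: "gm_admissible V E D"
  shows "cospectral V E V (gm_switch V E D)"
proof -
  define m where "m = real (card D)"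
  have fD: "finite D" using V finite_subset by auto
  have m0: "m > 0" unfolding m_def using V(3) fD by (simp add: card_gt_0_iff)
  define E' where "E' = gm_switch V E D"
  define a where "a x y = (of_bool ({x, y} \<in> E) :: real)" for x y
  define a' where "a' x y = (of_bool ({x, y} \<in> E') :: real)" for x y
  define P where "P x y = (if x \<in> D \<and> y \<in> D then 2 / m else 0)
    + (if x = y then if x \<in> D then - 1 else 1 else 0)" for x y :: nat
  define dg where "dg x = (\<Sum>y\<in>D. a x y)" for x
  define dg' where "dg' x = (\<Sum>y\<in>D. a' x y)" for x
  have P_sym: "P x y = P y x" for x y unfolding P_def by auto
  have a_sym: "a x y = a y x" "a' x y = a' y x" for x y
    unfolding a_def a'_def by (simp_all add: insert_commute)
  have sumP: "(\<Sum>y\<in>V. f y * P y z) = (if z \<in> D then 2 / m * (\<Sum>y\<in>D. f y) - f z else f z)"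
    if "z \<in> V" for f z
  proof -
    have "(\<Sum>y\<in>V. f y * P y z) = (\<Sum>y\<in>V. if y \<in> D then (if z \<in> D then 2 / m * f y else 0) else 0)
        + (\<Sum>y\<in>V. if y = z then f y * (if z \<in> D then - 1 else 1) else 0)"
      unfolding sum.distrib[symmetric] P_def by (intro sum.cong) (auto simp: algebra_simps)
    also have "(\<Sum>y\<in>V. if y \<in> D then (if z \<in> D then 2 / m * f y else 0) else 0)
        = (\<Sum>y\<in>D. if z \<in> D then 2 / m * f y else 0)"
      using V by (simp add: sum.inter_restrict[symmetric] Int_absorb1)
    also have "(\<Sum>y\<in>V. if y = z then f y * (if z \<in> D then - 1 else 1) else 0)
        = f z * (if z \<in> D then - 1 else 1)" using V that by simp
    finally show ?thesis by (cases "z \<in> D") (simp_all add: sum_distrib_left)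
  qed
  have sumP': "(\<Sum>y\<in>V. P x y * f y) = (if x \<in> D then 2 / m * (\<Sum>y\<in>D. f y) - f x else f x)"
    if "x \<in> V" for f x
    using sumP[OF that, of f] by (simp add: P_sym[of x] mult.commute)
  have dg_card: "dg x = real (card {y \<in> D. {x, y} \<in> E})" for x
    unfolding dg_def a_def using fD by (simp add: of_bool_def sum.inter_filter[symmetric])
  obtain d where d: "\<And>x. x \<in> D \<Longrightarrow> dg x = d"
    using adm unfolding gm_admissible_def dg_card by fastforce
  have out: "dg x = 0 \<or> dg x = m \<or> 2 * dg x = m" if "x \<in> V - D" for x
    using adm that unfolding gm_admissible_def dg_card m_def by force
  have half: "x \<in> gm_half V E D \<longleftrightarrow> x \<in> V - D \<and> 2 * dg x = m" for x
    unfolding gm_half_def dg_card m_def by auto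
  have a'_in: "a' x y = a x y" if "x \<in> D \<longleftrightarrow> y \<in> D" for x y
    using that half unfolding a_def a'_def E'_def gm_switch_iff by auto
  \<comment> \<open>One formula for all three cases: it yields \<open>0\<close>, \<open>1\<close>
    and \<open>1 - a x z\<close> when \<open>x\<close> sees none, all and half of \<open>D\<close>,
    and it is the entry that multiplication by \<open>P\<close> produces.\<close>
  have a'_cross: "a' x z = 2 / m * dg x - a x z" if x: "x \<in> V - D" and z: "z \<in> D" for x z
  proof -
    have z_le: "\<forall>y\<in>D. 0 \<le> a x y \<and> a x y \<le> 1" unfolding a_def by auto
    consider "dg x = 0" | "dg x = m" | "2 * dg x = m" using out[OF x] by blast
    then show ?thesis
    proof cases
      case 1
      then have "a x z = 0" using fD z z_le unfolding dg_def by (simp add: sum_nonneg_eq_0_iff)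
      moreover have "x \<notin> gm_half V E D" using half 1 m0 by auto
      ultimately show ?thesis using 1 x z half[of z] unfolding a_def a'_def E'_def gm_switch_iff by auto
    next
      case 2
      then have "(\<Sum>y\<in>D. 1 - a x y) = 0" unfolding dg_def m_def by (simp add: sum_subtractf)
      then have "a x z = 1" using fD z z_le by (subst (asm) sum_nonneg_eq_0_iff) auto
      moreover have "x \<notin> gm_half V E D" using half 2 m0 by auto
      ultimately show ?thesis using 2 m0 x z half[of z] unfolding a_def a'_def E'_def gm_switch_iff by auto
    next
      case 3
      then have "x \<in> gm_half V E D" using half x by auto
      moreover have "2 / m * dg x = 1" using 3 m0 by (simp add: field_simps)
      ultimately show ?thesis using z unfolding a_def a'_def E'_def gm_switch_iff by auto
    qed
  qed
  have dg'_out: "dg' x = dg x" if x: "x \<in> V - D" for x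
  proof -
    have "dg' x = (\<Sum>z\<in>D. 2 / m * dg x - a x z)"
      unfolding dg'_def using a'_cross[OF x] by simp
    also have "\<dots> = m * (2 / m * dg x) - dg x" unfolding dg_def[of x] m_def
      by (simp add: sum_subtractf)
    finally show ?thesis using m0 by simp
  qed
  have dg'_in: "dg' x = d" if "x \<in> D" for x
    using a'_in[of x] that d[OF that] unfolding dg'_def dg_def by simp
  show ?thesis unfolding E'_def[symmetric]
  proof (rule cospectral_of_intertwining[OF V(1), of E P])
    fix x z assume xz: "x \<in> V" "z \<in> V"
    have "(\<Sum>y\<in>V. a x y * P y z) = (if z \<in> D then 2 / m * dg x - a x z else a x z)"
      using sumP[OF xz(2)] unfolding dg_def .
    \<comment> \<open>Inside \<open>D\<close> both sides agree by regularity. The mixed entries are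
      \<open>a'_cross\<close>, for \<open>x \<in> D\<close> in transposed form and with
      \<open>dg'\<close> in place of \<open>dg\<close>.\<close>
    also have "\<dots> = (if x \<in> D then 2 / m * dg' z - a' x z else a' x z)"
    proof (cases "x \<in> D"; cases "z \<in> D")
      assume "x \<in> D" "z \<in> D" then show ?thesis using d dg'_in a'_in by simp
    next
      assume "x \<in> D" "z \<notin> D"
      then have "a' z x = 2 / m * dg' z - a z x" using a'_cross[of z x] dg'_out[of z] xz by simp
      then show ?thesis using \<open>x \<in> D\<close> \<open>z \<notin> D\<close> a_sym by simp
    next
      assume "x \<notin> D" "z \<in> D" then show ?thesis using a'_cross[of x z] xz by simp
    next
      assume "x \<notin> D" "z \<notin> D" then show ?thesis using a'_in by simp
    qed
    also have "\<dots> = (\<Sum>y\<in>V. P x y * a' y z)"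
      using sumP'[OF xz(1), of "\<lambda>y. a' y z"] a_sym(2)[of z] unfolding dg'_def by simp
    finally show "(\<Sum>y\<in>V. of_bool ({x, y} \<in> E) * P y z) = (\<Sum>y\<in>V. P x y * of_bool ({y, z} \<in> E'))"
      unfolding a_def a'_def .
    have PD: "(\<Sum>y\<in>D. P x y) = 1" if "x \<in> D"
      using that m0 fD V(3) unfolding P_def m_def by (simp add: sum.distrib)
    have PD': "(\<Sum>y\<in>D. P x y) = 0" if "x \<notin> D"
      using that unfolding P_def by (intro sum.neutral) auto
    show "(\<Sum>y\<in>V. P x y * P y z) = of_bool (x = z)"
    proof (cases "z \<in> D")
      case True
      then have "(\<Sum>y\<in>V. P x y * P y z) = 2 / m * (if x \<in> D then 1 else 0) - P x z"
        using sumP[OF xz(2), of "P x"] PD PD' by simp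
      then show ?thesis using True unfolding P_def by auto
    next
      case False
      then have "(\<Sum>y\<in>V. P x y * P y z) = P x z" using sumP[OF xz(2), of "P x"] by simp
      then show ?thesis using False unfolding P_def by auto
    qed
  qed
qed

text \<open>Complementing exchanges none and all, keeps half, and preserves regularity on
  \<open>D\<close>. Hence the same pairs are switched, which yields cospectral complements.\<close>

lemma gm_compl:
  assumes V: "finite V" "D \<subseteq> V" and E: "E \<subseteq> all_edges V" and adm: "gm_admissible V E D"
  shows "gm_admissible V (compl_edges V E) D"
    and "gm_switch V (compl_edges V E) D = compl_edges V (gm_switch V E D)"
proof -
  have fD: "finite D" using V finite_subset by auto
  have card_out: "card {y \<in> D. {x, y} \<in> compl_edges V E} = card D - card {y \<in> D. {x, y} \<in> E}"
    and le: "card {y \<in> D. {x, y} \<in> E} \<le> card D" if "x \<in> V - D" for x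
  proof -
    have "{y \<in> D. {x, y} \<in> compl_edges V E} = D - {y \<in> D. {x, y} \<in> E}"
      using that V unfolding compl_edges_def by (auto simp: all_edges_iff)
    then show "card {y \<in> D. {x, y} \<in> compl_edges V E} = card D - card {y \<in> D. {x, y} \<in> E}"
      using fD by (simp add: card_Diff_subset)
    show "card {y \<in> D. {x, y} \<in> E} \<le> card D" using fD by (intro card_mono) auto
  qed
  have card_in: "card {y \<in> D. {x, y} \<in> compl_edges V E} = card D - 1 - card {y \<in> D. {x, y} \<in> E}"
    if "x \<in> D" for x
  proof -
    \<comment> \<open>There are no loops, so \<open>x\<close> is missing from both of its
      neighbourhoods in \<open>D\<close>; hence the \<open>- 1\<close>.\<close>
    have "{x} \<notin> E" using E all_edges_iff[of x x V] by auto
    then have "{y \<in> D. {x, y} \<in> compl_edges V E} = (D - {x}) - {y \<in> D. {x, y} \<in> E}"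
      and "{y \<in> D. {x, y} \<in> E} \<subseteq> D - {x}"
      using that V unfolding compl_edges_def by (auto simp: all_edges_iff)
    then show ?thesis using fD that by (simp add: card_Diff_subset finite_subset)
  qed
  show "gm_admissible V (compl_edges V E) D"
    unfolding gm_admissible_def
  proof (intro conjI ballI)
    obtain d where "\<forall>x\<in>D. card {y \<in> D. {x, y} \<in> E} = d" using adm unfolding gm_admissible_def by auto
    then have "\<forall>x\<in>D. card {y \<in> D. {x, y} \<in> compl_edges V E} = card D - 1 - d" using card_in by auto
    then show "\<exists>d. \<forall>x\<in>D. card {y \<in> D. {x, y} \<in> compl_edges V E} = d" by blast
  next
    fix x assume x: "x \<in> V - D"
    then have "card {y \<in> D. {x, y} \<in> E} \<in> {0, card D} \<or> 2 * card {y \<in> D. {x, y} \<in> E} = card D"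
      using adm unfolding gm_admissible_def by auto
    then show "card {y \<in> D. {x, y} \<in> compl_edges V E} \<in> {0, card D}
      \<or> 2 * card {y \<in> D. {x, y} \<in> compl_edges V E} = card D"
      unfolding card_out[OF x] by auto
  qed
  have "gm_half V (compl_edges V E) D = gm_half V E D"
    unfolding gm_half_def
  proof (intro Collect_cong conj_cong refl)
    fix x assume x: "x \<in> V - D"
    show "(2 * card {y \<in> D. {x, y} \<in> compl_edges V E} = card D)
        \<longleftrightarrow> (2 * card {y \<in> D. {x, y} \<in> E} = card D)"
      using card_out[OF x] le[OF x] by linarith
  qed
  moreover have "cross_edges (gm_half V E D) D \<subseteq> all_edges V"
    using V(2) unfolding cross_edges_def gm_half_def by (auto simp: all_edges_iff)
  ultimately show "gm_switch V (compl_edges V E) D = compl_edges V (gm_switch V E D)"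
    using E unfolding gm_switch_def compl_edges_def by auto
qed

lemma has_R_cospectral_mate_imp: "has_R_cospectral_mate V E \<Longrightarrow> has_cospectral_mate V E"
  unfolding has_R_cospectral_mate_def has_cospectral_mate_def by blast

section \<open>Switching in a spider\<close>

lemma not_graph_iso_isolated:
  assumes "\<forall>x\<in>V. \<exists>y\<in>V. {x, y} \<in> E" "c \<in> V'" "\<forall>y\<in>V'. {c, y} \<notin> E'"
  shows "\<not> graph_iso V E V' E'"
proof
  assume "graph_iso V E V' E'"
  then obtain f where f: "bij_betw f V V'" "\<forall>x\<in>V. \<forall>y\<in>V. {x, y} \<in> E \<longleftrightarrow> {f x, f y} \<in> E'"
    unfolding graph_iso_def by blast
  obtain x where x: "x \<in> V" "f x = c" using f(1) assms(2) unfolding bij_betw_def by auto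
  obtain y where "y \<in> V" "{x, y} \<in> E" using assms(1) x by auto
  then show False using f x assms(3) unfolding bij_betw_def by blast
qed

text \<open>A spider with center \<open>c\<close>, legs \<open>c - x_i - a_i\<close> and only the vertices \<open>x_i\<close> attached to the
  rest of the graph: switching with respect to the center and the leaves isolates the center
  and turns the six other vertices into a hexagon.\<close>

lemma spider_mate:
  assumes V: "finite V" "E \<subseteq> all_edges V" "{c, a1, a2, a3, x1, x2, x3} \<subseteq> V"
    and dist: "distinct [c, a1, a2, a3, x1, x2, x3]"
    and edges: "touching E {c, a1, a2, a3} = {{c, x1}, {c, x2}, {c, x3}, {a1, x1}, {a2, x2}, {a3, x3}}"
    and noiso: "\<forall>x\<in>V. \<exists>y\<in>V. {x, y} \<in> E"
  shows "has_R_cospectral_mate V E"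
proof -
  define D where "D = {c, a1, a2, a3}"
  have D: "D \<subseteq> V" "D \<noteq> {}" "card D = 4" using V(3) dist unfolding D_def by auto
  have inE: "{x, y} \<in> E \<longleftrightarrow> {x, y} \<in> {{c, x1}, {c, x2}, {c, x3}, {a1, x1}, {a2, x2}, {a3, x3}}"
    if "y \<in> D" for x y
    using that unfolding edges[symmetric] touching_def D_def by auto
  \<comment> \<open>\<open>D\<close> is independent, each \<open>x_i\<close> sees the center and its
    own leaf, that is half of \<open>D\<close>, and all other vertices see nothing of
    \<open>D\<close>.\<close>
  have nb: "{y \<in> D. {x, y} \<in> E} =
      (if x = x1 then {c, a1} else if x = x2 then {c, a2} else if x = x3 then {c, a3} else {})" for x
    using dist by (auto simp: inE doubleton_eq_iff D_def)
  have card_nb: "card {y \<in> D. {x, y} \<in> E} = (if x \<in> {x1, x2, x3} then 2 else 0)" for x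
    unfolding nb using dist by auto
  have adm: "gm_admissible V E D"
    unfolding gm_admissible_def card_nb D(3) using dist by (auto simp: D_def)
  have half: "gm_half V E D = {x1, x2, x3}"
    unfolding gm_half_def card_nb D(3) using V(3) dist by (auto simp: D_def)
  \<comment> \<open>All neighbours of \<open>c\<close> lie in \<open>gm_half\<close>, so switching
    removes every edge at \<open>c\<close> and adds none.\<close>
  have iso: "\<forall>y\<in>V. {c, y} \<notin> gm_switch V E D"
    unfolding gm_switch_iff half using dist inE[of c] by (auto simp: D_def insert_commute doubleton_eq_iff)
  have "simple_graph V (gm_switch V E D)"
    unfolding simple_graph_def using V(1) gm_switch_subset[OF D(1) V(2)] by blast
  moreover have "\<not> graph_iso V E V (gm_switch V E D)"
    by (rule not_graph_iso_isolated[OF noiso _ iso]) (use V(3) in auto)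
  moreover have "cospectral V E V (gm_switch V E D)"
    by (rule gm_switch_cospectral[OF V(1) D(1,2) adm])
  moreover have "cospectral V (compl_edges V E) V (compl_edges V (gm_switch V E D))"
    using gm_switch_cospectral[OF V(1) D(1,2) gm_compl(1)[OF V(1) D(1) V(2) adm]]
    unfolding gm_compl(2)[OF V(1) D(1) V(2) adm] .
  ultimately show ?thesis unfolding has_R_cospectral_mate_def by blast
qed

text \<open>Center \<open>1\<close>, legs \<open>1 - 0 - 2\<close>, \<open>1 - 3 - 4\<close> and
  \<open>1 - 5 - 6\<close>; the root \<open>0\<close> is a middle vertex.\<close>

definition spider_par :: "nat \<Rightarrow> nat" where
  "spider_par i = (if i = 3 \<or> i = 5 then 1 else if i = 4 then 3 else if i = 6 then 5 else 0)"

interpretation spider: parent_tree spider_par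
  by unfold_locales (auto simp: spider_par_def)

lemma tree_edges_spider:
  assumes "card S = 7"
  shows "tree_edges spider_par S = {{vtx S 1, vtx S 0}, {vtx S 2, vtx S 0}, {vtx S 3, vtx S 1},
    {vtx S 4, vtx S 3}, {vtx S 5, vtx S 1}, {vtx S 6, vtx S 5}}"
proof -
  have "{1..<card S} = {1, 2, 3, 4, 5, 6}" using assms by auto
  then show ?thesis unfolding tree_edges_def by (simp add: spider_par_def)
qed

text \<open>By minimality a singleton in a larger component is not closed, so some edge leaves
  it.\<close>

lemma component_without_isolated_vertices:
  assumes C: "is_component E C" and E: "E \<subseteq> all_edges V" and "2 \<le> card C"
  shows "\<forall>x\<in>C. \<exists>y\<in>C. {x, y} \<in> induced_edges E C"
proof
  fix x assume x: "x \<in> C"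
  have "\<not> C \<subseteq> {x}"
  proof
    assume "C \<subseteq> {x}"
    then have "card C \<le> card {x}" by (intro card_mono) auto
    then show False using assms(3) by simp
  qed
  then have "\<not> edge_closed E {x}" using is_component_minimal[OF C, of "{x}" x] x by blast
  then obtain e where e: "e \<in> E" "x \<in> e" unfolding edge_closed_def by auto
  have "card e = 2" using e(1) E unfolding all_edges_def by auto
  then obtain y where y: "e = {x, y}" using e(2) by (auto simp: card_2_iff)
  have "e \<subseteq> C" using is_component_closed[OF C] e x unfolding edge_closed_def by blast
  then show "\<exists>y\<in>C. {x, y} \<in> induced_edges E C" using e(1) y unfolding induced_edges_def by auto
qed

text \<open>The limb hangs from a middle vertex, so the center and the leaves have no neighbours
  outside the spider and \<open>spider_mate\<close> applies inside \<open>C\<close>.\<close>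

lemma spider_limb_mate:
  assumes E: "E \<subseteq> all_edges {0..<n}" and C: "C \<in> components {0..<n} E"
    and not: "\<not> spider.limbless 7 E C"
  shows "has_R_cospectral_mate C (induced_edges E C)"
proof -
  obtain S w where S: "S \<subseteq> C" "card S = 7" "w \<notin> S" and limb: "is_limb spider_par E S w"
    using not unfolding spider.limbless_def by blast
  have C': "is_component E C" "C \<subseteq> {0..<n}" using components_is_component[OF C E] .
  have fC: "finite C" using C'(2) by (rule finite_subset) simp
  have fS: "finite S" using S(1) fC by (rule finite_subset)
  have cC: "2 \<le> card C" using card_mono[OF fC S(1)] S(2) by simp
  let ?v = "vtx S"
  have v_in: "?v i \<in> S" if "i < 7" for i using vtx_in[OF fS, of i] that S(2) by simp
  have v_inj: "?v i = ?v j \<longleftrightarrow> i = j" if "i < 7" "j < 7" for i j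
    using vtx_inj[OF fS, of i j] that S(2) by simp
  \<comment> \<open>The switching set: the center \<open>1\<close> and the leaves \<open>2\<close>,
    \<open>4\<close>, \<open>6\<close>.\<close>
  let ?D = "{?v 1, ?v 2, ?v 4, ?v 6}"
  have D: "?D \<subseteq> S" using v_in by auto
  have closed: "edge_closed E C" using C'(1) by (rule is_component_closed)
  have "touching (induced_edges E C) ?D = touching (touching E S) ?D"
  proof
    show "touching (induced_edges E C) ?D \<subseteq> touching (touching E S) ?D"
      using D unfolding touching_def induced_edges_def by blast
    show "touching (touching E S) ?D \<subseteq> touching (induced_edges E C) ?D"
      using closed S(1) unfolding touching_def induced_edges_def edge_closed_def by blast
  qed
  also have "touching E S = insert {?v 0, w} (tree_edges spider_par S)"
    using limb unfolding is_limb_def limb_edges_def .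
  also have "touching (insert {?v 0, w} (tree_edges spider_par S)) ?D = tree_edges spider_par S"
  proof -
    have "{?v 0, w} \<inter> ?D = {}" using v_inj D S(3) by auto
    moreover have "\<forall>e\<in>tree_edges spider_par S. e \<inter> ?D \<noteq> {}"
      unfolding tree_edges_spider[OF S(2)] by auto
    ultimately show ?thesis unfolding touching_def by auto
  qed
  finally have touch: "touching (induced_edges E C) ?D = {{?v 1, ?v 0}, {?v 1, ?v 3}, {?v 1, ?v 5},
      {?v 2, ?v 0}, {?v 4, ?v 3}, {?v 6, ?v 5}}"
    unfolding tree_edges_spider[OF S(2)] by (simp add: insert_commute)
  show ?thesis
  proof (rule spider_mate[OF fC _ _ _ touch])
    show "induced_edges E C \<subseteq> all_edges C"
      using E unfolding induced_edges_def all_edges_def by auto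
    show "{?v 1, ?v 2, ?v 4, ?v 6, ?v 0, ?v 3, ?v 5} \<subseteq> C" using v_in S(1) by auto
    show "distinct [?v 1, ?v 2, ?v 4, ?v 6, ?v 0, ?v 3, ?v 5]" by (simp add: v_inj)
    show "\<forall>x\<in>C. \<exists>y\<in>C. {x, y} \<in> induced_edges E C"
      by (rule component_without_isolated_vertices[OF C'(1) E cC])
  qed
qed

section \<open>Probability estimates\<close>

text \<open>Moving a limb to each of the at least \<open>m\<close> vertices of a limbless largest component preserves
  the number of edges, hence the weight, and only the old attachment vertex is lost.\<close>

lemma (in parent_tree) gnp_prob_largest_limbless:
  assumes p: "0 \<le> p" "p \<le> 1" and k: "1 \<le> k" "k < m" and L: "0 \<le> L"
  shows "gnp_prob n p (\<lambda>E. (\<exists>C\<in>largest_components {0..<n} E. limbless k E C \<and> m \<le> card C)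
      \<and> L \<le> real (limb_count par n k E)) * (L * real m) \<le> real n"
proof -
  define A where "A = all_edges {0..<n}"
  let ?Q = "\<lambda>E C. C \<in> largest_components {0..<n} E \<and> limbless k E C \<and> m \<le> card C"
  define B where "B = {E \<in> Pow A. (\<exists>C. ?Q E C) \<and> L \<le> real (limb_count par n k E)}"
  \<comment> \<open>Several largest components may qualify; one is fixed for each graph.\<close>
  define Cf where "Cf E = (SOME C. ?Q E C)" for E
  define I where "I E = {(S, w) \<in> limb_index n k. is_limb par E S w}" for E
  define Dom where "Dom = (SIGMA E:B. I E \<times> Cf E)"
  \<comment> \<open>The old attachment vertex \<open>w\<close> is not visible in the new graph and
    is recorded; its \<open>n\<close> values cause the factor \<open>n\<close> of the bound.\<close>
  define \<Phi> where "\<Phi> = (\<lambda>(E, (S, w), w'). (move_limb E S w w', w :: nat))"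
  define wt where "wt = edge_weight n p"
  have fA: "finite A" unfolding A_def by simp
  have fB: "finite B" unfolding B_def using fA by simp
  have Cf: "?Q E (Cf E)" if "E \<in> B" for E
    using that someI_ex[of "?Q E"] unfolding B_def Cf_def by blast
  have fI: "finite (I E)" for E unfolding I_def by (rule finite_subset[of _ "limb_index n k"]) auto
  have fC: "finite (Cf E)" if "E \<in> B" for E
  proof -
    have "Cf E \<in> components {0..<n} E" using Cf[OF that] unfolding largest_components_def by blast
    then have "Cf E \<subseteq> {0..<n}"
      using components_is_component(2) that unfolding B_def A_def by blast
    then show ?thesis by (rule finite_subset) simp
  qed
  have move: "limb_move par n k E S w (Cf E) w'" if "(E, (S, w), w') \<in> Dom" for E S w w'
  proof -
    have *: "E \<in> B" "(S, w) \<in> limb_index n k" "is_limb par E S w" "w' \<in> Cf E"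
      using that unfolding Dom_def I_def by auto
    note ix = limb_indexD(1-4)[OF *(2) k(1)]
    show ?thesis
      by unfold_locales (use ix * Cf[OF *(1)] k(1) in \<open>auto simp: B_def A_def\<close>)
  qed
  have wt_eq: "wt (fst x) = wt (fst (\<Phi> x)) \<and> \<Phi> x \<in> Pow A \<times> {0..<n}" if xD: "x \<in> Dom" for x
  proof -
    obtain E S w w' where x: "x = (E, (S, w), w')" by (metis prod.collapse)
    interpret limb_move par n k E S w "Cf E" w' using move xD unfolding x .
    show ?thesis unfolding x \<Phi>_def wt_def edge_weight_def using card_E' E'_subset w(1)
      by (simp add: A_def)
  qed
  have inj: "inj_on \<Phi> Dom"
  proof (rule inj_onI)
    fix x y assume xy: "x \<in> Dom" "y \<in> Dom" "\<Phi> x = \<Phi> y"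
    obtain E1 S1 v1 w1 where x: "x = (E1, (S1, v1), w1)" by (metis prod.collapse)
    obtain E2 S2 v2 w2 where y: "y = (E2, (S2, v2), w2)" by (metis prod.collapse)
    have v: "v1 = v2" and eq: "move_limb E1 S1 v1 w1 = move_limb E2 S2 v2 w2"
      using xy(3) unfolding x y \<Phi>_def by auto
    have "E1 \<in> B" using xy(1) unfolding x Dom_def by auto
    then have "k < card (Cf E1)" using Cf k(2) by fastforce
    from move_limb_inj[OF move[OF xy(1)[unfolded x]] move[OF xy(2)[unfolded y], folded v] this]
    show "x = y" using eq v unfolding x y by auto
  qed
  have "gnp_prob n p (\<lambda>E. (\<exists>C\<in>largest_components {0..<n} E. limbless k E C \<and> m \<le> card C)
      \<and> L \<le> real (limb_count par n k E)) = (\<Sum>E\<in>B. wt E)"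
    unfolding gnp_prob_def B_def wt_def edge_weight_def A_def using fA[unfolded A_def]
    by (subst sum.inter_filter) (auto intro!: sum.cong simp: Bex_def)
  then have "gnp_prob n p (\<lambda>E. (\<exists>C\<in>largest_components {0..<n} E. limbless k E C \<and> m \<le> card C)
      \<and> L \<le> real (limb_count par n k E)) * (L * real m) = (\<Sum>E\<in>B. wt E * (L * real m))"
    by (simp add: sum_distrib_right)
  also have "\<dots> \<le> (\<Sum>E\<in>B. wt E * real (card (I E \<times> Cf E)))"
  proof (intro sum_mono mult_left_mono)
    fix E assume E: "E \<in> B"
    have "L \<le> real (card (I E))" using E unfolding B_def I_def limb_count_def by blast
    moreover have "real m \<le> real (card (Cf E))" using Cf[OF E] by simp
    ultimately show "L * real m \<le> real (card (I E \<times> Cf E))"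
      using L unfolding card_cartesian_product of_nat_mult by (intro mult_mono) auto
    show "0 \<le> wt E" unfolding wt_def using p by (rule edge_weight_nonneg)
  qed
  also have "\<dots> = (\<Sum>E\<in>B. \<Sum>y\<in>I E \<times> Cf E. wt E)" by (simp add: mult.commute)
  also have "\<dots> = (\<Sum>x\<in>Dom. wt (fst x))"
    unfolding Dom_def using fB fI fC by (subst sum.Sigma) (auto simp: case_prod_beta)
  also have "\<dots> = (\<Sum>x\<in>Dom. wt (fst (\<Phi> x)))" using wt_eq by (intro sum.cong) auto
  also have "\<dots> = (\<Sum>y\<in>\<Phi> ` Dom. wt (fst y))" using sum.reindex[OF inj, of "\<lambda>y. wt (fst y)"] by simp
  also have "\<dots> \<le> (\<Sum>y\<in>Pow A \<times> {0..<n}. wt (fst y))"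
  proof (rule sum_mono2)
    show "\<Phi> ` Dom \<subseteq> Pow A \<times> {0..<n}" using wt_eq by blast
  qed (use fA p in \<open>simp_all add: wt_def edge_weight_nonneg\<close>)
  also have "\<dots> = real n * (\<Sum>E\<in>Pow A. wt E)"
    by (simp add: sum.cartesian_product' sum_distrib_left)
  also have "(\<Sum>E\<in>Pow A. wt E) = 1"
    using gnp_expect_one[of n p] unfolding gnp_expect_def wt_def A_def by simp
  finally show ?thesis by simp
qed

section \<open>Balanced cuts without edges\<close>

lemma card_cross_edges:
  assumes "A \<inter> B = {}"
  shows "card (cross_edges A B) = card A * card B"
proof -
  have "cross_edges A B = (\<lambda>(x, y). {x, y}) ` (A \<times> B)" unfolding cross_edges_def by auto
  moreover have "inj_on (\<lambda>(x, y). {x, y}) (A \<times> B)"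
    using assms by (auto simp: inj_on_def doubleton_eq_iff)
  ultimately show ?thesis by (simp add: card_image card_cartesian_product)
qed

lemma gnp_prob_edge_closed:
  assumes "0 \<le> p" "p \<le> 1" "A \<subseteq> {0..<n}"
  shows "gnp_prob n p (\<lambda>E. edge_closed E A) \<le> (1 - p) ^ (card A * (n - card A))"
proof -
  let ?M = "cross_edges A ({0..<n} - A)"
  have fA: "finite A" using assms(3) by (rule finite_subset) simp
  have "?M \<subseteq> all_edges {0..<n}"
    using assms(3) unfolding cross_edges_def by (auto simp: all_edges_iff)
  then have "gnp_prob n p (\<lambda>E. E \<inter> ?M = {}) = (1 - p) ^ card ?M"
    using gnp_prob_cylinder[of ?M n "{}" p] by simp
  also have "card ?M = card A * (n - card A)"
    using assms(3) fA by (subst card_cross_edges) (auto simp: card_Diff_subset)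
  finally have "gnp_prob n p (\<lambda>E. E \<inter> ?M = {}) = (1 - p) ^ (card A * (n - card A))" .
  moreover have "gnp_prob n p (\<lambda>E. edge_closed E A) \<le> gnp_prob n p (\<lambda>E. E \<inter> ?M = {})"
    by (rule gnp_prob_mono[OF assms(1,2)]) (auto simp: edge_closed_def cross_edges_def)
  ultimately show ?thesis by simp
qed

text \<open>Greedy choice: unite the components of \<open>0\<close>, \<open>1\<close>, and so on
  until at least \<open>n / 3\<close> vertices are covered. The last component adds fewer than
  \<open>n / 3\<close>, so at most \<open>2 * n / 3\<close> are covered.\<close>

lemma small_components_balanced_cut:
  assumes E: "E \<subseteq> all_edges {0..<n}" and "0 < n"
    and small: "\<forall>C\<in>components {0..<n} E. 3 * card C < n"
  shows "\<exists>A\<in>Pow {0..<n}. edge_closed E A \<and> n \<le> 3 * card A \<and> 3 * card A \<le> 2 * n"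
proof -
  let ?c = "component_of {0..<n} E"
  define A where "A j = (\<Union>v\<in>{0..<j}. ?c v)" for j
  have cc: "is_component E (?c v)" "v \<in> ?c v" "?c v \<subseteq> {0..<n}" if "v < n" for v
    using component_of_is_component[of v "{0..<n}" E] E that by auto
  have sub: "A j \<subseteq> {0..<n}" if "j \<le> n" for j unfolding A_def component_of_def by auto
  have cl: "edge_closed E (A j)" if "j \<le> n" for j
    unfolding edge_closed_def
  proof (intro ballI impI)
    fix e assume e: "e \<in> E" "e \<inter> A j \<noteq> {}"
    then obtain y where y: "y \<in> e" "y \<in> A j" by blast
    then obtain v where v: "v < j" "y \<in> ?c v" unfolding A_def by auto
    have "edge_closed E (?c v)" using cc(1)[of v] v(1) that is_component_closed by simp
    then have "e \<subseteq> ?c v" using e(1) v(2) y(1) unfolding edge_closed_def by blast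
    then show "e \<subseteq> A j" using v(1) unfolding A_def by auto
  qed
  have "{0..<n} \<subseteq> A n" using cc(2) unfolding A_def by auto
  then have "A n = {0..<n}" using sub[of n] by auto
  then have ex: "n \<le> 3 * card (A n)" by simp
  define j where "j = (LEAST j. n \<le> 3 * card (A j))"
  have j: "n \<le> 3 * card (A j)" unfolding j_def using ex by (rule LeastI)
  have jn: "j \<le> n" unfolding j_def using ex by (rule Least_le)
  have "A 0 = {}" unfolding A_def by simp
  then have "j \<noteq> 0" using j \<open>0 < n\<close> by (intro notI) simp
  then obtain i where i: "j = Suc i" using not0_implies_Suc by blast
  have "\<not> n \<le> 3 * card (A i)" using not_less_Least[of i "\<lambda>j. n \<le> 3 * card (A j)"] i
    unfolding j_def[symmetric] by simp
  moreover have "A j = A i \<union> ?c i" unfolding i A_def by (auto simp: less_Suc_eq)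
  then have "card (A j) \<le> card (A i) + card (?c i)" using card_Un_le by metis
  moreover have "3 * card (?c i) < n" using small i jn unfolding components_def by auto
  ultimately have "3 * card (A j) \<le> 2 * n" by linarith
  then show ?thesis using sub[OF jn] cl[OF jn] j by blast
qed

text \<open>Union bound over all \<open>2 ^ n\<close> vertex sets; a balanced one has at least
  \<open>2 * n\<^sup>2 / 9\<close> pairs across it, all of them non-edges.\<close>

lemma gnp_prob_small_components:
  assumes p: "0 \<le> p" "p \<le> 1" and "0 < n"
  shows "gnp_prob n p (\<lambda>E. \<forall>C\<in>components {0..<n} E. 3 * card C < n)
    \<le> 2 ^ n * exp (- (2 * p * (real n)\<^sup>2 / 9))"
proof -
  let ?bal = "\<lambda>A. n \<le> 3 * card A \<and> 3 * card A \<le> 2 * n"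
  have "gnp_prob n p (\<lambda>E. \<forall>C\<in>components {0..<n} E. 3 * card C < n)
      \<le> gnp_prob n p (\<lambda>E. \<exists>A\<in>Pow {0..<n}. edge_closed E A \<and> ?bal A)"
    using small_components_balanced_cut[OF _ \<open>0 < n\<close>] by (intro gnp_prob_mono p) blast
  also have "\<dots> \<le> (\<Sum>A\<in>Pow {0..<n}. gnp_prob n p (\<lambda>E. edge_closed E A \<and> ?bal A))"
    by (intro gnp_prob_Bex_le p) simp
  also have "\<dots> \<le> (\<Sum>A\<in>Pow {0..<n}. exp (- (2 * p * (real n)\<^sup>2 / 9)))"
  proof (intro sum_mono)
    fix A assume A: "A \<in> Pow {0..<n}"
    show "gnp_prob n p (\<lambda>E. edge_closed E A \<and> ?bal A) \<le> exp (- (2 * p * (real n)\<^sup>2 / 9))"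
    proof (cases "?bal A")
      case False
      then have "gnp_prob n p (\<lambda>E. edge_closed E A \<and> ?bal A) = 0"
        unfolding gnp_prob_def by (intro sum.neutral) auto
      then show ?thesis by simp
    next
      case True
      define a where "a = real (card A)"
      have a: "real n \<le> 3 * a" "3 * a \<le> 2 * real n" using True unfolding a_def by linarith+
      have le: "card A \<le> n" using card_mono[of "{0..<n}" A] A by auto
      \<comment> \<open>The product expands to \<open>9 * a * (n - a) - 2 * n\<^sup>2\<close>; the
        number of crossing pairs is smallest at the ends of the range of \<open>a\<close>.\<close>
      have "0 \<le> (3 * a - real n) * (2 * real n - 3 * a)" using a by (intro mult_nonneg_nonneg) auto
      then have q: "2 * (real n)\<^sup>2 / 9 \<le> a * (real n - a)"
        by (simp add: power2_eq_square algebra_simps)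
      have "gnp_prob n p (\<lambda>E. edge_closed E A \<and> ?bal A) \<le> gnp_prob n p (\<lambda>E. edge_closed E A)"
        by (intro gnp_prob_mono p) auto
      also have "\<dots> \<le> (1 - p) ^ (card A * (n - card A))"
        using A by (intro gnp_prob_edge_closed p) auto
      also have "\<dots> \<le> exp (- p) ^ (card A * (n - card A))"
        using p exp_ge_add_one_self[of "- p"] by (intro power_mono) auto
      also have "\<dots> = exp (- (p * (a * (real n - a))))"
        using le by (simp add: exp_of_nat_mult[symmetric] a_def of_nat_diff mult.commute)
      also have "\<dots> \<le> exp (- (2 * p * (real n)\<^sup>2 / 9))"
        using mult_left_mono[OF q p(1)] by (simp add: mult.assoc mult.left_commute)
      finally show ?thesis .
    qed
  qed
  also have "\<dots> = 2 ^ n * exp (- (2 * p * (real n)\<^sup>2 / 9))" by (simp add: card_Pow)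
  finally show ?thesis .
qed

section \<open>Asymptotics\<close>

lemma choose_two_add_le: "(m + k) choose 2 \<le> (m choose 2) + k * (m + k)"
proof (induction k)
  case (Suc k)
  have "(m + Suc k) choose 2 = ((m + k) choose 2) + (m + k)"
    by (simp add: numeral_2_eq_2)
  then show ?case using Suc.IH by simp
qed simp

text \<open>Up to factors depending on \<open>k\<close>, there are \<open>n ^ (k + 1)\<close> index
  pairs, each a limb with probability about \<open>(x / n) ^ k * exp (- k * x)\<close>; the factor
  \<open>x ^ k \<ge> 1\<close> is dropped.\<close>

lemma limb_mean_ge:
  assumes k: "1 \<le> k" "2 * k \<le> n" and x: "1 \<le> x" "2 * x \<le> real n" "x\<^sup>2 \<le> real n"
  shows "(1 / (3 * real k)) ^ k / 2 * exp (- 2 * real k) * (real n * exp (- real k * x))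
    \<le> limb_mean n (x / real n) k"
proof -
  define p where "p = x / real n"
  have n: "2 \<le> n" using k by simp
  have p: "0 < p" "p \<le> 1 / 2" "p < 1" using x n unfolding p_def by (auto simp: field_simps)
  have np: "real n * p = x" using n unfolding p_def by simp
  have c1: "card (limb_index n k) = ((n div 2) choose k) * (n - n div 2)"
    unfolding limb_index_def by (simp add: card_cartesian_product n_subsets)
  have "n \<le> 3 * (n div 2)" using n by presburger
  then have "real n \<le> real (3 * (n div 2))" by (simp only: of_nat_le_iff)
  then have "real n / 3 \<le> real (n div 2)" by simp
  then have "(real n / (3 * real k)) ^ k \<le> (real (n div 2) / real k) ^ k"
    using k by (intro power_mono) (auto simp: field_simps)
  also have "\<dots> \<le> real ((n div 2) choose k)"
    by (rule binomial_ge_n_over_k_pow_k) (use k in simp)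
  finally have c2: "(real n / (3 * real k)) ^ k \<le> real ((n div 2) choose k)" .
  have "n \<le> 2 * (n - n div 2)" by presburger
  then have "real n \<le> real (2 * (n - n div 2))" by (simp only: of_nat_le_iff)
  then have c3: "real n / 2 \<le> real (n - n div 2)" by simp
  have c4: "(real n / (3 * real k)) ^ k * (real n / 2) \<le> real (card (limb_index n k))"
    unfolding c1 of_nat_mult using c2 c3 by (intro mult_mono) auto
  have "(n choose 2) \<le> ((n - k) choose 2) + k * n" using choose_two_add_le[of "n - k" k] k by simp
  then have j: "(n choose 2) - ((n - k) choose 2) - k \<le> k * n" by linarith
  \<comment> \<open>Prepares \<open>ln (1 - p) \<ge> - p - 2 * p\<^sup>2\<close> over at most
    \<open>k * n\<close> non-edges. As \<open>n * p\<^sup>2 \<le> 1\<close>, the quadratic term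
    costs at most the factor \<open>exp (- 2 * k)\<close>.\<close>
  have "exp (- real k * x - 2 * real k) \<le> exp (real (k * n) * (- p - 2 * p\<^sup>2))"
  proof -
    have "real n * p\<^sup>2 \<le> 1" using x(3) n unfolding p_def by (simp add: power2_eq_square field_simps)
    then have "real k * (2 * (real n * p\<^sup>2)) \<le> real k * (2 * 1)" by (intro mult_left_mono) auto
    moreover have "real (k * n) * (- p - 2 * p\<^sup>2) = - real k * (real n * p) - real k * (2 * (real n * p\<^sup>2))"
      by (simp add: algebra_simps)
    ultimately show ?thesis unfolding np by simp
  qed
  also have "\<dots> \<le> exp (real (k * n) * ln (1 - p))"
    using ln_one_minus_pos_lower_bound[of p] p by (auto intro!: mult_left_mono)
  also have "\<dots> = (1 - p) ^ (k * n)" unfolding exp_of_nat_mult using p by simp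
  also have "\<dots> \<le> (1 - p) ^ ((n choose 2) - ((n - k) choose 2) - k)"
    using p j by (intro power_decreasing) auto
  finally have e: "exp (- real k * x - 2 * real k) \<le> (1 - p) ^ ((n choose 2) - ((n - k) choose 2) - k)" .
  have "(1 / (3 * real k)) ^ k / 2 * exp (- 2 * real k) * (real n * exp (- real k * x))
      = (real n / (3 * real k)) ^ k * (real n / 2) * ((1 / real n) ^ k * exp (- real k * x - 2 * real k))"
    using n by (simp add: power_divide exp_diff exp_minus divide_simps)
  also have "\<dots> \<le> (real n / (3 * real k)) ^ k * (real n / 2) * (p ^ k * exp (- real k * x - 2 * real k))"
    using x n unfolding p_def by (intro mult_left_mono mult_right_mono power_mono divide_right_mono) auto
  also have "\<dots> \<le> real (card (limb_index n k)) * limb_prob n p k"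
    unfolding limb_prob_def using c4 e p by (intro mult_mono mult_left_mono) auto
  finally show ?thesis unfolding limb_mean_def p_def .
qed

lemma limb_mean_at_top:
  assumes k: "1 \<le> k" and x: "\<forall>\<^sub>F n in sequentially. 1 \<le> x n"
    and small: "(\<lambda>n. (x n)\<^sup>2 / real n) \<longlonglongrightarrow> 0"
    and big: "filterlim (\<lambda>n. real n * exp (- real k * x n)) at_top sequentially"
  shows "filterlim (\<lambda>n. limb_mean n (x n / real n) k) at_top sequentially"
proof -
  define c where "c = (1 / (3 * real k)) ^ k / 2 * exp (- 2 * real k)"
  have c: "c > 0" unfolding c_def using k by simp
  have "filterlim (\<lambda>n. c * (real n * exp (- real k * x n))) at_top sequentially"
    using c big by (rule filterlim_tendsto_pos_mult_at_top[OF tendsto_const])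
  moreover have "\<forall>\<^sub>F n in sequentially. c * (real n * exp (- real k * x n)) \<le> limb_mean n (x n / real n) k"
    using x order_tendstoD(2)[OF small, of "1/2", simplified] eventually_ge_at_top[of "2 * k"]
  proof eventually_elim
    case (elim n)
    then have n: "n > 0" using k by simp
    \<comment> \<open>With \<open>1 \<le> x n\<close> this gives both upper bounds on
      \<open>x n\<close> in \<open>limb_mean_ge\<close>, hence the choice of \<open>1/2\<close>
      above.\<close>
    have sq: "2 * (x n)\<^sup>2 \<le> real n" using elim(2) n by (simp add: field_simps)
    moreover have "x n \<le> (x n)\<^sup>2" using elim(1) by (simp add: power2_eq_square)
    ultimately show ?case unfolding c_def using limb_mean_ge[OF k elim(3) elim(1)] by simp
  qed
  ultimately show ?thesis by (rule filterlim_at_top_mono)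
qed

text \<open>As \<open>1 \<le> x n\<close>, the edge probability is at most
  \<open>(x n)\<^sup>2 / n\<close> and vanishes, while the mean diverges; so both Chebyshev error
  terms vanish.\<close>

lemma (in parent_tree) limb_count_concentration_asymp:
  assumes k: "1 \<le> k" and x: "\<forall>\<^sub>F n in sequentially. 1 \<le> x n"
    and small: "(\<lambda>n. (x n)\<^sup>2 / real n) \<longlonglongrightarrow> 0"
    and big: "filterlim (\<lambda>n. real n * exp (- real k * x n)) at_top sequentially"
  shows "(\<lambda>n. gnp_prob n (x n / real n)
      (\<lambda>E. real (limb_count par n k E) \<le> limb_mean n (x n / real n) k / 2)) \<longlonglongrightarrow> 0"
proof -
  define p where "p n = x n / real n" for n
  have p0: "p \<longlonglongrightarrow> 0"
  proof (rule tendsto_sandwich[OF _ _ tendsto_const small])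
    show "\<forall>\<^sub>F n in sequentially. 0 \<le> p n" using x by eventually_elim (simp add: p_def)
    show "\<forall>\<^sub>F n in sequentially. p n \<le> (x n)\<^sup>2 / real n"
      using x by eventually_elim (auto simp: p_def power2_eq_square intro!: divide_right_mono)
  qed
  have mean: "filterlim (\<lambda>n. limb_mean n (p n) k) at_top sequentially"
    unfolding p_def by (rule limb_mean_at_top[OF assms])
  have "(\<lambda>n. 4 / limb_mean n (p n) k) \<longlonglongrightarrow> 0"
    using mean by (rule tendsto_divide_0[OF tendsto_const filterlim_at_top_imp_at_infinity])
  moreover have "(\<lambda>n. 4 * (1 / (1 - p n) ^ (k\<^sup>2) - 1)) \<longlonglongrightarrow> 4 * (1 / (1 - 0) ^ (k\<^sup>2) - 1)"
    by (intro tendsto_intros p0) simp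
  ultimately have lim: "(\<lambda>n. 4 / limb_mean n (p n) k + 4 * (1 / (1 - p n) ^ (k\<^sup>2) - 1)) \<longlonglongrightarrow> 0"
    by (auto intro: tendsto_eq_intros)
  have ev: "\<forall>\<^sub>F n in sequentially. 0 < p n \<and> p n < 1 \<and> 0 < limb_mean n (p n) k"
    using x order_tendstoD(2)[OF p0, of 1, simplified] eventually_gt_at_top[of "0::nat"]
      filterlim_at_top_dense[THEN iffD1, OF mean, rule_format, of 0]
    by eventually_elim (simp add: p_def)
  show ?thesis unfolding p_def[symmetric]
  proof (rule tendsto_sandwich[OF _ _ tendsto_const lim])
    show "\<forall>\<^sub>F n in sequentially. 0 \<le> gnp_prob n (p n)
        (\<lambda>E. real (limb_count par n k E) \<le> limb_mean n (p n) k / 2)"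
      using ev by eventually_elim (simp add: gnp_prob_nonneg)
    show "\<forall>\<^sub>F n in sequentially. gnp_prob n (p n)
        (\<lambda>E. real (limb_count par n k E) \<le> limb_mean n (p n) k / 2)
        \<le> 4 / limb_mean n (p n) k + 4 * (1 / (1 - p n) ^ (k\<^sup>2) - 1)"
      using ev by eventually_elim (intro limb_count_concentration k, simp_all)
  qed
qed

text \<open>The vertices of a limb are connected and thus share a component.\<close>

lemma (in parent_tree) limb_count_pos_large_component:
  assumes E: "E \<subseteq> all_edges {0..<n}" and k: "1 \<le> k" and pos: "0 < limb_count par n k E"
  shows "\<exists>C\<in>components {0..<n} E. k \<le> card C"
proof -
  obtain S w where S: "(S, w) \<in> limb_index n k" and limb: "is_limb par E S w"
    using pos unfolding limb_count_def by (auto dest!: card_gt_0_iff[THEN iffD1])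
  note S' = limb_indexD(1-6)[OF S k]
  have r: "vtx S 0 \<in> S" using vtx_in[OF S'(6), of 0] S'(2) k by simp
  then have rn: "vtx S 0 \<in> {0..<n}" using S'(1) by auto
  note c = component_of_is_component[OF rn E]
  have "S \<subseteq> component_of {0..<n} E (vtx S 0)"
    using limb_subset_closed[OF S'(6) _ is_component_closed[OF c(1)] r c(2)]
      is_limb_tree_edge[OF limb] by blast
  then have "k \<le> card (component_of {0..<n} E (vtx S 0))"
    using S'(2) card_mono[OF finite_subset[OF c(3)]] by auto
  then show ?thesis using rn unfolding components_def by blast
qed

text \<open>The star; as a source of large components a limb matters only through its size.\<close>

lemma constant_parent_tree: "parent_tree (\<lambda>_. 0)"
  by unfold_locales simp

text \<open>For bounded \<open>x\<close> and fixed \<open>m\<close> the mean number of limbs on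
  \<open>m\<close> vertices, of order at least \<open>n * exp (- m * x)\<close>, diverges; so such a
  limb, and a component containing it, is likely to exist.\<close>

lemma gnp_prob_bounded_components_tendsto_0:
  assumes x: "\<forall>\<^sub>F n in sequentially. 1 \<le> x n" "\<forall>\<^sub>F n in sequentially. x n \<le> b" and m: "1 \<le> m"
  shows "(\<lambda>n. gnp_prob n (x n / real n) (\<lambda>E. \<forall>C\<in>components {0..<n} E. card C < m)) \<longlonglongrightarrow> 0"
proof -
  interpret parent_tree "\<lambda>_. 0" by (rule constant_parent_tree)
  have small: "(\<lambda>n. (x n)\<^sup>2 / real n) \<longlonglongrightarrow> 0"
  proof (rule tendsto_sandwich[OF _ _ tendsto_const])
    show "(\<lambda>n. b\<^sup>2 / real n) \<longlonglongrightarrow> 0" by real_asymp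
    show "\<forall>\<^sub>F n in sequentially. 0 \<le> (x n)\<^sup>2 / real n" by simp
    show "\<forall>\<^sub>F n in sequentially. (x n)\<^sup>2 / real n \<le> b\<^sup>2 / real n"
      using x by eventually_elim (intro divide_right_mono power_mono, auto)
  qed
  have big: "filterlim (\<lambda>n. real n * exp (- real m * x n)) at_top sequentially"
  proof (rule filterlim_at_top_mono)
    have "0 < exp (- real m * b)" by simp
    then show "filterlim (\<lambda>n. real n * exp (- real m * b)) at_top sequentially" by real_asymp
    show "\<forall>\<^sub>F n in sequentially. real n * exp (- real m * b) \<le> real n * exp (- real m * x n)"
      using x(2) by eventually_elim (auto intro!: mult_left_mono)
  qed
  show ?thesis
  proof (rule tendsto_sandwich[OF _ _ tendsto_const limb_count_concentration_asymp[OF m x(1) small big]])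
    have ev: "\<forall>\<^sub>F n in sequentially. 0 \<le> x n / real n \<and> x n / real n \<le> 1"
      using x eventually_ge_at_top[of "nat \<lceil>b\<rceil> + 1"]
    proof eventually_elim
      case (elim n)
      then have "x n \<le> real n" "0 < n" by linarith+
      then show ?case using elim by simp
    qed
    show "\<forall>\<^sub>F n in sequentially. 0 \<le> gnp_prob n (x n / real n) (\<lambda>E. \<forall>C\<in>components {0..<n} E. card C < m)"
      using ev by eventually_elim (simp add: gnp_prob_nonneg)
    have mean: "\<forall>\<^sub>F n in sequentially. 0 < limb_mean n (x n / real n) m"
      using limb_mean_at_top[OF m x(1) small big] unfolding filterlim_at_top_dense by blast
    show "\<forall>\<^sub>F n in sequentially. gnp_prob n (x n / real n) (\<lambda>E. \<forall>C\<in>components {0..<n} E. card C < m)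
        \<le> gnp_prob n (x n / real n)
            (\<lambda>E. real (limb_count (\<lambda>_. 0) n m E) \<le> limb_mean n (x n / real n) m / 2)"
      using ev mean
    proof eventually_elim
      case (elim n)
      show ?case
      proof (rule gnp_prob_mono)
        fix E assume E: "E \<subseteq> all_edges {0..<n}" "\<forall>C\<in>components {0..<n} E. card C < m"
        then have "\<not> 0 < limb_count (\<lambda>_. 0) n m E"
          using limb_count_pos_large_component[OF E(1) m] by force
        then show "real (limb_count (\<lambda>_. 0) n m E) \<le> limb_mean n (x n / real n) m / 2"
          using elim by simp
      qed (use elim in auto)
    qed
  qed
qed

text \<open>Three causes of failure: few spider limbs, no component with \<open>m\<close> vertices,
  or a limbless largest component despite many limbs. Double counting bounds the last.\<close>

lemma gnp_prob_no_mate_le: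
  assumes p: "0 \<le> p" "p \<le> 1" and m: "7 < m" and L: "0 < L"
  shows "gnp_prob n p (\<lambda>E. \<not> (\<forall>C\<in>largest_components {0..<n} E. has_R_cospectral_mate C (induced_edges E C)))
    \<le> gnp_prob n p (\<lambda>E. real (limb_count spider_par n 7 E) \<le> L)
      + gnp_prob n p (\<lambda>E. \<forall>C\<in>components {0..<n} E. card C < m)
      + real n / (L * real m)"
proof -
  let ?X = "\<lambda>E. real (limb_count spider_par n 7 E)"
  let ?B = "\<lambda>E. (\<exists>C\<in>largest_components {0..<n} E. spider.limbless 7 E C \<and> m \<le> card C) \<and> L \<le> ?X E"
  have "gnp_prob n p ?B * (L * real m) \<le> real n"
    using spider.gnp_prob_largest_limbless[OF p _ m, of L n] L by simp
  then have B: "gnp_prob n p ?B \<le> real n / (L * real m)"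
    using L m by (simp add: pos_le_divide_eq)
  have "gnp_prob n p (\<lambda>E. \<not> (\<forall>C\<in>largest_components {0..<n} E. has_R_cospectral_mate C (induced_edges E C)))
      \<le> gnp_prob n p (\<lambda>E. (?X E \<le> L \<or> (\<forall>C\<in>components {0..<n} E. card C < m)) \<or> ?B E)"
  proof (rule gnp_prob_mono[OF p])
    fix E assume E: "E \<subseteq> all_edges {0..<n}"
      and "\<not> (\<forall>C\<in>largest_components {0..<n} E. has_R_cospectral_mate C (induced_edges E C))"
    then obtain C where C: "C \<in> largest_components {0..<n} E" "\<not> has_R_cospectral_mate C (induced_edges E C)"
      by blast
    then have C': "C \<in> components {0..<n} E" "\<forall>C'\<in>components {0..<n} E. card C' \<le> card C"
      unfolding largest_components_def by auto
    have "spider.limbless 7 E C" using spider_limb_mate[OF E C'(1)] C(2) by blast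
    moreover have "m \<le> card C \<or> (\<forall>C\<in>components {0..<n} E. card C < m)"
      using C'(2) by (meson le_less_trans not_le)
    ultimately show "(?X E \<le> L \<or> (\<forall>C\<in>components {0..<n} E. card C < m)) \<or> ?B E"
      using C(1) by fastforce
  qed
  also have "\<dots> \<le> gnp_prob n p (\<lambda>E. ?X E \<le> L \<or> (\<forall>C\<in>components {0..<n} E. card C < m)) + gnp_prob n p ?B"
    by (rule gnp_prob_disj_le[OF p])
  also have "\<dots> \<le> (gnp_prob n p (\<lambda>E. ?X E \<le> L)
      + gnp_prob n p (\<lambda>E. \<forall>C\<in>components {0..<n} E. card C < m)) + real n / (L * real m)"
    by (intro add_mono B gnp_prob_disj_le[OF p])
  finally show ?thesis .
qed

text \<open>At the upper bound for \<open>x\<close>, \<open>n * exp (- 7 * x)\<close> equals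
  \<open>n\<close> to the power \<open>1 / 8\<close> divided by \<open>ln n ^ 7\<close>, which
  diverges.\<close>

lemma subthreshold_asymptotics:
  fixes x :: "nat \<Rightarrow> real"
  assumes "\<forall>\<^sub>F n in sequentially. 1 \<le> x n"
    and "\<forall>\<^sub>F n in sequentially. x n \<le> ln (real n) / 8 + ln (ln (real n))"
  shows "(\<lambda>n. (x n)\<^sup>2 / real n) \<longlonglongrightarrow> 0"
    and "filterlim (\<lambda>n. real n * exp (- real 7 * x n)) at_top sequentially"
proof -
  let ?g = "\<lambda>n. ln (real n) / 8 + ln (ln (real n))"
  show "(\<lambda>n. (x n)\<^sup>2 / real n) \<longlonglongrightarrow> 0"
  proof (rule tendsto_sandwich[OF _ _ tendsto_const])
    show "(\<lambda>n. (?g n)\<^sup>2 / real n) \<longlonglongrightarrow> 0" by real_asymp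
    show "\<forall>\<^sub>F n in sequentially. 0 \<le> (x n)\<^sup>2 / real n" by simp
    show "\<forall>\<^sub>F n in sequentially. (x n)\<^sup>2 / real n \<le> (?g n)\<^sup>2 / real n"
      using assms by eventually_elim (intro divide_right_mono power_mono, auto)
  qed
  show "filterlim (\<lambda>n. real n * exp (- real 7 * x n)) at_top sequentially"
  proof (rule filterlim_at_top_mono)
    show "filterlim (\<lambda>n. real n * exp (- 7 * ?g n)) at_top sequentially" by real_asymp
    show "\<forall>\<^sub>F n in sequentially. real n * exp (- 7 * ?g n) \<le> real n * exp (- real 7 * x n)"
      using assms(2) by eventually_elim (intro mult_left_mono, auto)
  qed
qed

text \<open>The sequence may cross \<open>9\<close> infinitely often, so the two regimes are
  separated for each \<open>n\<close>; in both, each of the three error terms is below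
  \<open>e / 3\<close>.\<close>

theorem giant_R_cospectral_mate:
  fixes x :: "nat \<Rightarrow> real"
  assumes x1: "\<forall>\<^sub>F n in sequentially. 1 \<le> x n"
    and x2: "\<forall>\<^sub>F n in sequentially. x n \<le> ln (real n) / 8 + ln (ln (real n))"
  shows "(\<lambda>n. gnp_prob n (x n / real n)
    (\<lambda>E. \<forall>C\<in>largest_components {0..<n} E. has_R_cospectral_mate C (induced_edges E C))) \<longlonglongrightarrow> 1"
proof -
  let ?good = "\<lambda>n E. \<forall>C\<in>largest_components {0..<n} E. has_R_cospectral_mate C (induced_edges E C)"
  let ?small = "\<lambda>m n E. \<forall>C\<in>components {0..<n} E. card C < m"
  define p where "p n = x n / real n" for n
  define \<mu> where "\<mu> n = limb_mean n (p n) 7" for n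
  define fail where "fail n = gnp_prob n (p n) (\<lambda>E. \<not> ?good n E)" for n
  define few where "few n = gnp_prob n (p n) (\<lambda>E. real (limb_count spider_par n 7 E) \<le> \<mu> n / 2)" for n
  \<comment> \<open>The constant of \<open>limb_mean_ge\<close> for \<open>k = 7\<close>.\<close>
  define c :: real where "c = (1 / 21) ^ 7 / 2 * exp (- 14)"
  have c: "c > 0" unfolding c_def by simp
  note small = subthreshold_asymptotics(1)[OF x1 x2] and big = subthreshold_asymptotics(2)[OF x1 x2]
  have few: "few \<longlonglongrightarrow> 0"
    using spider.limb_count_concentration_asymp[OF _ x1 small big] unfolding few_def \<mu>_def p_def by simp
  have mu: "filterlim \<mu> at_top sequentially"
    using limb_mean_at_top[OF _ x1 small big] unfolding \<mu>_def p_def by simp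
  have ev: "\<forall>\<^sub>F n in sequentially. 1 \<le> x n \<and> 0 < p n \<and> p n \<le> 1 \<and> 0 < \<mu> n \<and> 30 \<le> n
      \<and> c * (real n * exp (- 7 * x n)) \<le> \<mu> n"
    using x1 order_tendstoD(2)[OF small, of "1/2", simplified] eventually_ge_at_top[of "30::nat"]
      filterlim_at_top_dense[THEN iffD1, OF mu, rule_format, of 0]
  proof eventually_elim
    case (elim n)
    have sq: "2 * (x n)\<^sup>2 \<le> real n" using elim(2,3) by (simp add: field_simps)
    moreover have "x n \<le> (x n)\<^sup>2" using elim(1) by (simp add: power2_eq_square)
    ultimately show ?case using limb_mean_ge[of 7 n "x n"] elim
      unfolding c_def \<mu>_def p_def by simp
  qed
  have "\<forall>\<^sub>F n in sequentially. fail n < e" if e: "e > 0" for e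
  proof -
    \<comment> \<open>For \<open>x n \<le> 9\<close> the double-counting term is at most
      \<open>2 * exp 63 / (c * m)\<close>, which this choice pushes below \<open>e / 3\<close>; the
      \<open>8\<close> ensures \<open>7 < m\<close>.\<close>
    define m where "m = nat \<lceil>6 * exp 63 / (c * e)\<rceil> + 8"
    have m: "7 < m" "6 * exp 63 / (c * e) < real m" unfolding m_def by linarith+
    \<comment> \<open>Truncation gives a bounded sequence to which the component estimate applies;
      it agrees with \<open>x\<close> wherever \<open>x n \<le> 9\<close>.\<close>
    define y where "y n = min (x n) 9" for n
    have "(\<lambda>n. gnp_prob n (y n / real n) (?small m n)) \<longlonglongrightarrow> 0"
    proof (rule gnp_prob_bounded_components_tendsto_0)
      show "\<forall>\<^sub>F n in sequentially. 1 \<le> y n" using x1 by eventually_elim (simp add: y_def)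
      show "\<forall>\<^sub>F n in sequentially. y n \<le> 9" by (simp add: y_def)
    qed (use m in simp)
    then have y: "\<forall>\<^sub>F n in sequentially. gnp_prob n (y n / real n) (?small m n) < e / 3"
      using e by (intro order_tendstoD(2)) auto
    have few': "\<forall>\<^sub>F n in sequentially. few n < e / 3"
      using few e by (intro order_tendstoD(2)) auto
    have "(\<lambda>n. 2 ^ n * exp (- 2 * real n)) \<longlonglongrightarrow> 0" by real_asymp
    then have cut: "\<forall>\<^sub>F n in sequentially. 2 ^ n * exp (- 2 * real n) < e / 3"
      using e by (intro order_tendstoD(2)) auto
    have mu': "\<forall>\<^sub>F n in sequentially. 18 / e < \<mu> n"
      using mu unfolding filterlim_at_top_dense by blast
    show ?thesis using ev y few' cut mu'
    proof eventually_elim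
      case (elim n)
      have p: "0 \<le> p n" "p n \<le> 1" and \<mu>: "0 < \<mu> n / 2" and n: "30 \<le> n" using elim(1) by auto
      have bound: "fail n \<le> few n + gnp_prob n (p n) (?small k n) + real n / (\<mu> n / 2 * real k)"
        if "7 < k" for k
        unfolding fail_def few_def using gnp_prob_no_mate_le[OF p that \<mu>] .
      show "fail n < e"
      proof (cases "x n \<le> 9")
        case True
        then have "y n / real n = p n" unfolding y_def p_def by simp
        then have s: "gnp_prob n (p n) (?small m n) < e / 3" using elim(2) by simp
        have "exp (- 63) \<le> exp (- 7 * x n)" using True by simp
        then have "c * (real n * exp (- 63)) \<le> c * (real n * exp (- 7 * x n))"
          using c by (intro mult_left_mono) auto
        then have "c * real n * exp (- 63) \<le> \<mu> n" using elim(1) by (simp add: mult.assoc)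
        then have "2 * real n / (\<mu> n * real m) \<le> 2 * real n / (c * real n * exp (- 63) * real m)"
          using c n m(1) \<mu> by (intro divide_left_mono mult_right_mono) auto
        also have "\<dots> = 2 * exp 63 / (c * real m)"
          using n by (simp add: exp_minus field_simps)
        also have "\<dots> < e / 3" using m c e by (simp add: field_simps)
        finally have "real n / (\<mu> n / 2 * real m) < e / 3" by (simp add: field_simps)
        then show ?thesis using bound[OF m(1)] s elim(3) by linarith
      next
        case False
        \<comment> \<open>The ceiling of \<open>n / 3\<close>, so that sizes below \<open>k\<close>
          are those with \<open>3 * j < n\<close>; \<open>30 \<le> n\<close> gives
          \<open>7 < k\<close>.\<close>
        define k where "k = (n + 2) div 3"
        have k: "7 < k" "n \<le> 3 * k" "\<And>j. j < k \<longleftrightarrow> 3 * j < n" unfolding k_def using n by auto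
        have "gnp_prob n (p n) (?small k n) \<le> 2 ^ n * exp (- (2 * p n * (real n)\<^sup>2 / 9))"
          unfolding k(3) using gnp_prob_small_components[OF p] n by simp
        also have "2 * p n * (real n)\<^sup>2 / 9 = 2 * x n * real n / 9"
          unfolding p_def using n by (simp add: power2_eq_square)
        \<comment> \<open>Since \<open>9 < x n\<close>, the exponent is below
          \<open>- 2 * n\<close>, and \<open>exp 2\<close> exceeds \<open>2\<close>.\<close>
        also have "2 ^ n * exp (- (2 * x n * real n / 9)) \<le> 2 ^ n * exp (- 2 * real n)"
          using False n by simp
        finally have s: "gnp_prob n (p n) (?small k n) < e / 3" using elim(4) by linarith
        have "real n \<le> 3 * real k" using k(2) by linarith
        then have "\<mu> n / 2 * real n \<le> \<mu> n / 2 * (3 * real k)" using \<mu> by (intro mult_left_mono) auto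
        then have "real n / (\<mu> n / 2 * real k) \<le> 6 / \<mu> n"
          using \<mu> k(1) by (simp add: field_simps)
        also have "\<dots> < e / 3" using elim(5) \<mu> e by (simp add: field_simps)
        finally show ?thesis using bound[OF k(1)] s elim(3) by linarith
      qed
    qed
  qed
  moreover have "\<forall>\<^sub>F n in sequentially. - e < fail n" if "e > 0" for e
    using ev
  proof eventually_elim
    case (elim n)
    then have "0 \<le> fail n" unfolding fail_def by (simp add: gnp_prob_nonneg)
    then show ?case using that by simp
  qed
  ultimately have "fail \<longlonglongrightarrow> 0"
    by (intro order_tendstoI) (metis neg_0_less_iff_less minus_minus, blast)
  then have "(\<lambda>n. 1 - fail n) \<longlonglongrightarrow> 1 - 0" by (intro tendsto_intros)
  then show ?thesis unfolding fail_def gnp_prob_not p_def by simp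
qed

text \<open>Eventually \<open>0 \<le> h n\<close> and \<open>ln n / 10 \<le> ln n / 8\<close>, so
  both bounds lead to \<open>giant_R_cospectral_mate\<close>; for the first part, an R-cospectral
  mate is in particular a cospectral mate.\<close>

theorem theorem1p1:
  fixes lam h :: "nat \<Rightarrow> real"
  assumes lam_gt1: "\<exists>c > 1. \<forall>\<^sub>F n in sequentially. lam n \<ge> c"
    and h_inf: "filterlim h at_top sequentially"
  shows "((\<forall>\<^sub>F n in sequentially. lam n \<le> ln (real n) / 8 + ln (ln (real n)) - h n) \<longrightarrow>
           (\<lambda>n. gnp_prob n (lam n / real n)
              (\<lambda>E. \<forall>C \<in> largest_components {0..<n} E.
                     has_cospectral_mate C (induced_edges E C))) \<longlonglongrightarrow> 1)
       \<and> ((\<forall>\<^sub>F n in sequentially. lam n \<le> ln (real n) / 10 + ln (ln (real n)) - h n) \<longrightarrow>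
           (\<lambda>n. gnp_prob n (lam n / real n)
              (\<lambda>E. \<forall>C \<in> largest_components {0..<n} E.
                     has_R_cospectral_mate C (induced_edges E C))) \<longlonglongrightarrow> 1)"
proof (intro conjI impI)
  obtain c where "c > 1" "\<forall>\<^sub>F n in sequentially. lam n \<ge> c" using lam_gt1 by blast
  then have lam1: "\<forall>\<^sub>F n in sequentially. 1 \<le> lam n" by (auto elim: eventually_mono)
  have h0: "\<forall>\<^sub>F n in sequentially. 0 \<le> h n" using h_inf unfolding filterlim_at_top by blast
  {
    assume "\<forall>\<^sub>F n in sequentially. lam n \<le> ln (real n) / 8 + ln (ln (real n)) - h n"
    with h0 have lam2: "\<forall>\<^sub>F n in sequentially. lam n \<le> ln (real n) / 8 + ln (ln (real n))"
      by eventually_elim simp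
    \<comment> \<open>Comparing the two events by \<open>gnp_prob_mono\<close> needs an edge
      probability in the unit interval.\<close>
    have "\<forall>\<^sub>F n in sequentially. lam n / real n \<le> 1"
      using lam1 order_tendstoD(2)[OF subthreshold_asymptotics(1)[OF lam1 lam2], of 1, simplified]
    proof eventually_elim
      case (elim n)
      have "lam n / real n \<le> (lam n)\<^sup>2 / real n"
        using elim(1) by (intro divide_right_mono) (auto simp: power2_eq_square)
      then show ?case using elim(2) by simp
    qed
    with lam1 have p: "\<forall>\<^sub>F n in sequentially. 0 \<le> lam n / real n \<and> lam n / real n \<le> 1"
      by eventually_elim simp
    show "(\<lambda>n. gnp_prob n (lam n / real n) (\<lambda>E. \<forall>C \<in> largest_components {0..<n} E.
        has_cospectral_mate C (induced_edges E C))) \<longlonglongrightarrow> 1"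
    proof (rule tendsto_sandwich[OF _ _ giant_R_cospectral_mate[OF lam1 lam2] tendsto_const])
      show "\<forall>\<^sub>F n in sequentially. gnp_prob n (lam n / real n) (\<lambda>E. \<forall>C \<in> largest_components {0..<n} E.
          has_R_cospectral_mate C (induced_edges E C)) \<le> gnp_prob n (lam n / real n)
          (\<lambda>E. \<forall>C \<in> largest_components {0..<n} E. has_cospectral_mate C (induced_edges E C))"
        using p by eventually_elim (intro gnp_prob_mono, auto simp: has_R_cospectral_mate_imp)
      show "\<forall>\<^sub>F n in sequentially. gnp_prob n (lam n / real n)
          (\<lambda>E. \<forall>C \<in> largest_components {0..<n} E. has_cospectral_mate C (induced_edges E C)) \<le> 1"
        using p by eventually_elim (simp add: gnp_prob_le_one)
    qed
  next
    assume "\<forall>\<^sub>F n in sequentially. lam n \<le> ln (real n) / 10 + ln (ln (real n)) - h n"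
    with h0 eventually_gt_at_top[of 0]
    have "\<forall>\<^sub>F n in sequentially. lam n \<le> ln (real n) / 8 + ln (ln (real n))"
    proof eventually_elim
      case (elim n)
      have "0 \<le> ln (real n)" using elim(2) by simp
      then show ?case using elim(1,3) by linarith
    qed
    then show "(\<lambda>n. gnp_prob n (lam n / real n) (\<lambda>E. \<forall>C \<in> largest_components {0..<n} E.
        has_R_cospectral_mate C (induced_edges E C))) \<longlonglongrightarrow> 1"
      by (rule giant_R_cospectral_mate[OF lam1])
  }
qed

end
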